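(* Let $\gamma:[a,b]\to\mathbf{H}^1$ be a $C^2$ horizontal curve in the seven dimensional quaternionic $H$-type group, parameterized by arc length. Then $\gamma$ is a critical point of the length functional (for all admissible variations of $\gamma$) if and only if there exist constants $\lambda_{\mathcal I},\lambda_{\mathcal J},\lambda_{\mathcal K}\in\mathbb{R}$ such that $\gamma$ satisfies the second order differential equation $$\nabla_{\dot\gamma}\dot\gamma-2\sum_{r=\mathcal I,\mathcal J,\mathcal K}\lambda_rJ_r(\dot\gamma)=0.$$
   Context: Let $$\mathcal I=\begin{pmatrix}0&1&0&0\\-1&0&0&0\\0&0&0&1\\0&0&-1&0\end{pmatrix},\ \mathcal J=\begin{pmatrix}0&0&0&-1\\0&0&-1&0\\0&1&0&0\\1&0&0&0\end{pmatrix},\ \mathcal K=\begin{pmatrix}0&0&-1&0\\0&0&0&1\\1&0&0&0\\0&-1&0&0\end{pmatrix}.$$ The group $\mathbf{H}^1$ is the manifold $\mathbb{R}^4\oplus\mathbb{R}^3$, with points $(x,z)$, $x=(x_1,\dots,x_4)$, $z=(z_{\mathcal I},z_{\mathcal J},z_{\mathcal K})$, and group law $(x,z)\circ(x',z')=(x+x',\,z'')$ with $z''_r=z_r+z'_r+\frac12 x'^T r\,x$ for $r=\mathcal I,\mathcal J,\mathcal K$. Its Lie algebra is spanned by the left invariant vector fields $X_1=\partial_{x_1}+\frac12(x_2\partial_{z_{\mathcal I}}-x_4\partial_{z_{\mathcal J}}-x_3\partial_{z_{\mathcal K}})$, $X_2=\partial_{x_2}+\frac12(-x_1\partial_{z_{\mathcal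 I}}-x_3\partial_{z_{\mathcal J}}+x_4\partial_{z_{\mathcal K}})$, $X_3=\partial_{x_3}+\frac12(x_4\partial_{z_{\mathcal I}}+x_2\partial_{z_{\mathcal J}}+x_1\partial_{z_{\mathcal K}})$, $X_4=\partial_{x_4}+\frac12(-x_3\partial_{z_{\mathcal I}}+x_1\partial_{z_{\mathcal J}}-x_2\partial_{z_{\mathcal K}})$, and $Z_r=\partial_{z_r}$, $r=\mathcal I,\mathcal J,\mathcal K$. The Riemannian metric $\langle\cdot,\cdot\rangle$ on $\mathbf H^1$ makes $X_1,\dots,X_4,Z_{\mathcal I},Z_{\mathcal J},Z_{\mathcal K}$ orthonormal, and $\nabla$ is its Levi-Civita connection. The horizontal distribution is $\mathcal D=\mathrm{span}\{X_1,X_2,X_3,X_4\}$; a curve is horizontal if its velocity lies in $\mathcal D$. The maps $J_r:\mathcal D\to\mathcal D$, $J_r(X)=2\nabla_XZ_r$, $r=\mathcal I,\mathcal J,\mathcal K$, are almost complex structures on $\mathcal D$. A variation of $\gamma:[a,b]\to\mathbf H^1$ is a $C^2$ map $(s,\varepsilon)\mapsto\gamma_\varepsilon(s)$, with $\varepsilon$ in an open interval containing $0$, with $\gamma_0=\gamma$. It is admissible if every $\gamma_\varepsilon$ is horizontal and $\gamma_\varepsilon(a)=\gamma(a)$, $\gamma_\varepsilon(b)=\gamma(b)$ for all $\varepsilon$. The curve $\gamma$ is a critical point of the length functional $L$ if $\frac{d}{d\varepsilon}\big|_{\varepsilon=0}L(\gamma_\varepsilon)=0$ for every admissible variation. *)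

theory Defs
  imports "HOL-Analysis.Analysis"
begin

section \<open>Functions of class C^k\<close>

text \<open>Derivatives are taken within \<open>S\<close>, so they are one-sided at the boundary of a closed interval.
  The predicate is meant for open sets, nondegenerate compact intervals and products of such sets,
  where the derivative within the set is unique. Continuity of all iterated directional derivatives
  is the usual C^k condition because the domain is finite-dimensional.\<close>

primrec Ck_on :: "nat \<Rightarrow> 'a::euclidean_space set \<Rightarrow> ('a \<Rightarrow> 'b::real_normed_vector) \<Rightarrow> bool" where
  "Ck_on 0 S f \<longleftrightarrow> continuous_on S f"
| "Ck_on (Suc k) S f \<longleftrightarrow>
     (\<exists>f'. (\<forall>x\<in>S. (f has_derivative f' x) (at x within S)) \<and> (\<forall>v. Ck_on k S (\<lambda>x. f' x v)))"

definition smooth :: "('a::euclidean_space \<Rightarrow> 'b::real_normed_vector) \<Rightarrow> bool" where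
  "smooth f \<longleftrightarrow> (\<forall>k. Ck_on k UNIV f)"


section \<open>Levi-Civita connections on a Euclidean space\<close>

text \<open>All tangent spaces of \<open>'a\<close> are identified with \<open>'a\<close> by the global chart; a vector field is a
  map \<open>'a \<Rightarrow> 'a\<close>. The norm and inner product of the type \<open>'a\<close> only serve to define derivatives;
  they are unrelated to the Riemannian metric \<open>g\<close>, whose value on tangent vectors \<open>u, v\<close> at \<open>p\<close>
  is \<open>g p u v\<close>.\<close>

definition riemannian_metric :: "('a::euclidean_space \<Rightarrow> 'a \<Rightarrow> 'a \<Rightarrow> real) \<Rightarrow> bool" where
  "riemannian_metric g \<longleftrightarrow>
     (\<forall>p. bilinear (g p) \<and> (\<forall>u v. g p u v = g p v u) \<and> (\<forall>u. u \<noteq> 0 \<longrightarrow> g p u u > 0)) \<and>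
     (\<forall>u v. smooth (\<lambda>p. g p u v))"

definition ddir :: "('a::euclidean_space \<Rightarrow> 'a) \<Rightarrow> ('a \<Rightarrow> 'b::real_normed_vector) \<Rightarrow> 'a \<Rightarrow> 'b" where
  "ddir X f p = frechet_derivative f (at p) (X p)"

definition lie_bracket :: "('a::euclidean_space \<Rightarrow> 'a) \<Rightarrow> ('a \<Rightarrow> 'a) \<Rightarrow> 'a \<Rightarrow> 'a" where
  "lie_bracket X Y p = ddir X Y p - ddir Y X p"

definition affine_connection ::
    "(('a::euclidean_space \<Rightarrow> 'a) \<Rightarrow> ('a \<Rightarrow> 'a) \<Rightarrow> ('a \<Rightarrow> 'a)) \<Rightarrow> bool" where
  "affine_connection nabla \<longleftrightarrow>
     (\<forall>X Y. smooth X \<longrightarrow> smooth Y \<longrightarrow> smooth (nabla X Y)) \<and>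
     (\<forall>X X' Y. smooth X \<longrightarrow> smooth X' \<longrightarrow> smooth Y \<longrightarrow>
        nabla (\<lambda>p. X p + X' p) Y = (\<lambda>p. nabla X Y p + nabla X' Y p)) \<and>
     (\<forall>f X Y. smooth f \<longrightarrow> smooth X \<longrightarrow> smooth Y \<longrightarrow>
        nabla (\<lambda>p. f p *\<^sub>R X p) Y = (\<lambda>p. f p *\<^sub>R nabla X Y p)) \<and>
     (\<forall>X Y Y'. smooth X \<longrightarrow> smooth Y \<longrightarrow> smooth Y' \<longrightarrow>
        nabla X (\<lambda>p. Y p + Y' p) = (\<lambda>p. nabla X Y p + nabla X Y' p)) \<and>
     (\<forall>f X Y. smooth f \<longrightarrow> smooth X \<longrightarrow> smooth Y \<longrightarrow>
        nabla X (\<lambda>p. f p *\<^sub>R Y p) = (\<lambda>p. ddir X f p *\<^sub>R Y p + f p *\<^sub>R nabla X Y p))"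

definition levi_civita ::
    "('a::euclidean_space \<Rightarrow> 'a \<Rightarrow> 'a \<Rightarrow> real) \<Rightarrow> (('a \<Rightarrow> 'a) \<Rightarrow> ('a \<Rightarrow> 'a) \<Rightarrow> ('a \<Rightarrow> 'a)) \<Rightarrow> bool" where
  "levi_civita g nabla \<longleftrightarrow> affine_connection nabla \<and>
     (\<forall>X Y. smooth X \<longrightarrow> smooth Y \<longrightarrow>
        (\<forall>p. nabla X Y p - nabla Y X p = lie_bracket X Y p)) \<and>
     (\<forall>X Y W. smooth X \<longrightarrow> smooth Y \<longrightarrow> smooth W \<longrightarrow>
        (\<forall>p. ddir X (\<lambda>q. g q (Y q) (W q)) p = g p (nabla X Y p) (W p) + g p (Y p) (nabla X W p)))"

text \<open>The value of \<open>nabla X Y\<close> at \<open>p\<close> depends on \<open>X\<close> only through \<open>X p\<close>; a tangent vector is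
  therefore extended to a constant vector field.\<close>

definition nabla_at ::
    "(('a::euclidean_space \<Rightarrow> 'a) \<Rightarrow> ('a \<Rightarrow> 'a) \<Rightarrow> ('a \<Rightarrow> 'a)) \<Rightarrow> 'a \<Rightarrow> 'a \<Rightarrow> ('a \<Rightarrow> 'a) \<Rightarrow> 'a" where
  "nabla_at nabla p v Y = nabla (\<lambda>_. v) Y p"

abbreviation velocity :: "real \<Rightarrow> real \<Rightarrow> (real \<Rightarrow> 'a::real_normed_vector) \<Rightarrow> real \<Rightarrow> 'a" where
  "velocity a b \<gamma> t \<equiv> vector_derivative \<gamma> (at t within {a..b})"

text \<open>The covariant derivative along \<open>\<gamma>\<close> of a vector field \<open>V\<close> along \<open>\<gamma>\<close>, in the global chart:
  expand \<open>V t\<close> in the coordinate frame, whose fields are constant, and apply the Leibniz rule. The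
  second summand is the Christoffel term.\<close>

definition cov_deriv ::
    "(('a::euclidean_space \<Rightarrow> 'a) \<Rightarrow> ('a \<Rightarrow> 'a) \<Rightarrow> ('a \<Rightarrow> 'a)) \<Rightarrow> real \<Rightarrow> real \<Rightarrow>
     (real \<Rightarrow> 'a) \<Rightarrow> (real \<Rightarrow> 'a) \<Rightarrow> real \<Rightarrow> 'a" where
  "cov_deriv nabla a b \<gamma> V t =
     velocity a b V t + nabla_at nabla (\<gamma> t) (velocity a b \<gamma> t) (\<lambda>_. V t)"


section \<open>The quaternionic H-type group\<close>

type_synonym h1 = "(real^4) \<times> (real^3)"

text \<open>The indices \<open>1, 2, 3\<close> of the centre stand for the letters I, J, K.\<close>

definition quat :: "3 \<Rightarrow> real^4^4" where
  "quat r = (vector [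
     vector [vector [ 0,  1,  0,  0],
             vector [-1,  0,  0,  0],
             vector [ 0,  0,  0,  1],
             vector [ 0,  0, -1,  0]],
     vector [vector [ 0,  0,  0, -1],
             vector [ 0,  0, -1,  0],
             vector [ 0,  1,  0,  0],
             vector [ 1,  0,  0,  0]],
     vector [vector [ 0,  0, -1,  0],
             vector [ 0,  0,  0,  1],
             vector [ 1,  0,  0,  0],
             vector [ 0, -1,  0,  0]]] :: real^4^4^3) $ r"

definition hmult :: "h1 \<Rightarrow> h1 \<Rightarrow> h1" where
  "hmult p q = (fst p + fst q, \<chi> r. snd p $ r + snd q $ r + 1/2 * (fst q \<bullet> (quat r *v fst p)))"

definition X_field :: "4 \<Rightarrow> h1 \<Rightarrow> h1" where
  "X_field i p = (axis i 1, \<chi> r. 1/2 * (quat r *v fst p) $ i)"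

definition Z_field :: "3 \<Rightarrow> h1 \<Rightarrow> h1" where
  "Z_field r p = (0, axis r 1)"

definition horizontal_space :: "h1 \<Rightarrow> h1 set" where
  "horizontal_space p = span (range (\<lambda>i. X_field i p))"

text \<open>\<open>fst v\<close> and \<open>z_coeff p v\<close> are the coordinates of \<open>v\<close> in the frame \<open>X_field\<close>, \<open>Z_field\<close> at \<open>p\<close>.\<close>

definition z_coeff :: "h1 \<Rightarrow> h1 \<Rightarrow> real^3" where
  "z_coeff p v = (\<chi> r. snd v $ r - 1/2 * (fst v \<bullet> (quat r *v fst p)))"

definition h1_metric :: "h1 \<Rightarrow> h1 \<Rightarrow> h1 \<Rightarrow> real" where
  "h1_metric p u v = fst u \<bullet> fst v + z_coeff p u \<bullet> z_coeff p v"

definition J_map :: "((h1 \<Rightarrow> h1) \<Rightarrow> (h1 \<Rightarrow> h1) \<Rightarrow> (h1 \<Rightarrow> h1)) \<Rightarrow> 3 \<Rightarrow> h1 \<Rightarrow> h1 \<Rightarrow> h1" where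
  "J_map nabla r p v = 2 *\<^sub>R nabla_at nabla p v (Z_field r)"


section \<open>Horizontal curves, length and variations\<close>

definition horizontal_curve :: "real \<Rightarrow> real \<Rightarrow> (real \<Rightarrow> h1) \<Rightarrow> bool" where
  "horizontal_curve a b \<gamma> \<longleftrightarrow> (\<forall>t\<in>{a..b}. velocity a b \<gamma> t \<in> horizontal_space (\<gamma> t))"

definition speed :: "real \<Rightarrow> real \<Rightarrow> (real \<Rightarrow> h1) \<Rightarrow> real \<Rightarrow> real" where
  "speed a b \<gamma> t = sqrt (h1_metric (\<gamma> t) (velocity a b \<gamma> t) (velocity a b \<gamma> t))"

definition curve_length :: "real \<Rightarrow> real \<Rightarrow> (real \<Rightarrow> h1) \<Rightarrow> real" where
  "curve_length a b \<gamma> = integral {a..b} (speed a b \<gamma>)"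

definition variation ::
    "real \<Rightarrow> real \<Rightarrow> (real \<Rightarrow> h1) \<Rightarrow> real set \<Rightarrow> (real \<Rightarrow> real \<Rightarrow> h1) \<Rightarrow> bool" where
  "variation a b \<gamma> U \<Gamma> \<longleftrightarrow>
     open U \<and> is_interval U \<and> 0 \<in> U \<and>
     Ck_on 2 ({a..b} \<times> U) (\<lambda>(s, \<epsilon>). \<Gamma> \<epsilon> s) \<and>
     (\<forall>s\<in>{a..b}. \<Gamma> 0 s = \<gamma> s)"

definition admissible_variation ::
    "real \<Rightarrow> real \<Rightarrow> (real \<Rightarrow> h1) \<Rightarrow> real set \<Rightarrow> (real \<Rightarrow> real \<Rightarrow> h1) \<Rightarrow> bool" where
  "admissible_variation a b \<gamma> U \<Gamma> \<longleftrightarrow> variation a b \<gamma> U \<Gamma> \<and>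
     (\<forall>\<epsilon>\<in>U. horizontal_curve a b (\<Gamma> \<epsilon>) \<and> \<Gamma> \<epsilon> a = \<gamma> a \<and> \<Gamma> \<epsilon> b = \<gamma> b)"

definition length_critical :: "real \<Rightarrow> real \<Rightarrow> (real \<Rightarrow> h1) \<Rightarrow> bool" where
  "length_critical a b \<gamma> \<longleftrightarrow>
     (\<forall>U \<Gamma>. admissible_variation a b \<gamma> U \<Gamma> \<longrightarrow>
        ((\<lambda>\<epsilon>. curve_length a b (\<Gamma> \<epsilon>)) has_real_derivative 0) (at 0))"


section \<open>Consistency of the definitions\<close>

subsection \<open>The frame\<close>

lemma vector_4:
  "(vector [x1,x2,x3,x4] :: 'a::zero^4) $ 1 = x1"
  "(vector [x1,x2,x3,x4] :: 'a^4) $ 2 = x2"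
  "(vector [x1,x2,x3,x4] :: 'a^4) $ 3 = x3"
  "(vector [x1,x2,x3,x4] :: 'a^4) $ 4 = x4"
  by (simp_all add: vector_def)

lemma quat_mult_vec:
  "quat 1 *v x = vector [x $ 2, - x $ 1, x $ 4, - x $ 3]"
  "quat 2 *v x = vector [- x $ 4, - x $ 3, x $ 2, x $ 1]"
  "quat 3 *v x = vector [- x $ 3, x $ 4, x $ 1, - x $ 2]"
  by (simp_all add: quat_def vec_eq_iff forall_4 matrix_vector_mult_def sum_4 vector_4)

lemma X_field_explicit:
  "X_field 1 (x, z) = (axis 1 1, vector [x $ 2 / 2, - x $ 4 / 2, - x $ 3 / 2])"
  "X_field 2 (x, z) = (axis 2 1, vector [- x $ 1 / 2, - x $ 3 / 2, x $ 4 / 2])"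
  "X_field 3 (x, z) = (axis 3 1, vector [x $ 4 / 2, x $ 2 / 2, x $ 1 / 2])"
  "X_field 4 (x, z) = (axis 4 1, vector [- x $ 3 / 2, x $ 1 / 2, - x $ 2 / 2])"
  by (simp_all add: X_field_def vec_eq_iff forall_3 quat_mult_vec vector_4)

lemma h1_metric_orthonormal:
  "h1_metric p (X_field i p) (X_field j p) = (if i = j then 1 else 0)"
  "h1_metric p (X_field i p) (Z_field r p) = 0"
  "h1_metric p (Z_field r p) (X_field i p) = 0"
  "h1_metric p (Z_field r p) (Z_field s p) = (if r = s then 1 else 0)"
proof -
  have zX: "z_coeff p (X_field i p) = 0" for i
    by (simp add: z_coeff_def X_field_def vec_eq_iff inner_axis')
  have zZ: "z_coeff p (Z_field r p) = axis r 1" for r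
    by (simp add: z_coeff_def Z_field_def vec_eq_iff)
  show "h1_metric p (X_field i p) (X_field j p) = (if i = j then 1 else 0)"
    "h1_metric p (X_field i p) (Z_field r p) = 0"
    "h1_metric p (Z_field r p) (X_field i p) = 0"
    "h1_metric p (Z_field r p) (Z_field s p) = (if r = s then 1 else 0)"
    by (simp_all add: h1_metric_def zX zZ) (simp_all add: X_field_def Z_field_def inner_axis_axis)
qed


lemma h1_frame_expansion:
  "v = (\<Sum>i\<in>UNIV. fst v $ i *\<^sub>R X_field i p) + (\<Sum>r\<in>UNIV. z_coeff p v $ r *\<^sub>R Z_field r p)"
  by (simp add: prod_eq_iff fst_sum snd_sum X_field_def Z_field_def vec_eq_iff z_coeff_def
      inner_vec_def axis_def if_distrib sum_distrib_left ac_simps cong: if_cong)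


lemma hmult_has_derivative:
  "(hmult p has_derivative (\<lambda>v. (fst v, \<chi> r. snd v $ r + 1/2 * (fst v \<bullet> (quat r *v fst p))))) (at q)"
proof -
  let ?A = "\<lambda>v. (fst v, \<chi> r. snd v $ r + 1/2 * (fst v \<bullet> (quat r *v fst p)))"
  have "linear ?A"
    by (rule linearI) (auto simp: vec_eq_iff inner_add_left algebra_simps)
  then have "bounded_linear ?A" by (rule linear_conv_bounded_linear[THEN iffD1])
  then have "((\<lambda>v. p + ?A v) has_derivative ?A) (at q)"
    using has_derivative_add[OF has_derivative_const bounded_linear_imp_has_derivative] by fastforce
  moreover have "(\<lambda>v. p + ?A v) = hmult p"
    by (auto simp: hmult_def prod_eq_iff vec_eq_iff)
  ultimately show ?thesis by simp
qed

lemma frame_left_invariant: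
  "frechet_derivative (hmult p) (at q) (X_field i q) = X_field i (hmult p q)"
  "frechet_derivative (hmult p) (at q) (Z_field r q) = Z_field r (hmult p q)"
  by (simp_all add: frechet_derivative_at[OF hmult_has_derivative, symmetric] X_field_def Z_field_def
      hmult_def vec_eq_iff inner_axis' matrix_vector_right_distrib algebra_simps)


subsection \<open>Closure properties of smooth functions\<close>

lemma Ck_on_Suc_D: "Ck_on (Suc k) S f \<Longrightarrow> Ck_on k S f"
proof (induction k arbitrary: f)
  case 0
  then show ?case
    by (auto simp: continuous_on_eq_continuous_within intro: has_derivative_continuous)
next
  case (Suc k)
  then obtain f' where "\<forall>x\<in>S. (f has_derivative f' x) (at x within S)"
    "\<forall>v. Ck_on (Suc k) S (\<lambda>x. f' x v)" by (subst (asm) (2) Ck_on.simps) auto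
  then show ?case using Suc.IH by auto
qed

lemma Ck_on_const: "Ck_on k S (\<lambda>_. c)"
proof (induction k arbitrary: c)
  case (Suc k)
  then show ?case by (auto intro!: exI[of _ "\<lambda>_ _. 0"])
qed simp

lemma Ck_on_add:
  "Ck_on k S f \<Longrightarrow> Ck_on k S g \<Longrightarrow> Ck_on k S (\<lambda>x. f x + g x)"
proof (induction k arbitrary: f g)
  case 0 then show ?case by (simp add: continuous_on_add)
next
  case (Suc k)
  then obtain f' g' where
    "\<forall>x\<in>S. (f has_derivative f' x) (at x within S)" "\<forall>v. Ck_on k S (\<lambda>x. f' x v)"
    "\<forall>x\<in>S. (g has_derivative g' x) (at x within S)" "\<forall>v. Ck_on k S (\<lambda>x. g' x v)"
    by auto
  then show ?case using Suc.IH
    by (auto intro!: exI[of _ "\<lambda>x v. f' x v + g' x v"] has_derivative_add)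
qed

lemma Ck_on_bilinear:
  assumes h: "bounded_bilinear h"
  shows "Ck_on k S f \<Longrightarrow> Ck_on k S g \<Longrightarrow> Ck_on k S (\<lambda>x. h (f x) (g x))"
proof (induction k arbitrary: f g)
  case 0 then show ?case by (simp add: bounded_bilinear.continuous_on[OF h])
next
  case (Suc k)
  then obtain f' g' where *:
    "\<forall>x\<in>S. (f has_derivative f' x) (at x within S)" "\<forall>v. Ck_on k S (\<lambda>x. f' x v)"
    "\<forall>x\<in>S. (g has_derivative g' x) (at x within S)" "\<forall>v. Ck_on k S (\<lambda>x. g' x v)"
    by auto
  have "Ck_on k S f" "Ck_on k S g" using Suc.prems Ck_on_Suc_D by blast+
  then have "\<forall>v. Ck_on k S (\<lambda>x. h (f x) (g' x v) + h (f' x v) (g x))"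
    using * Suc.IH by (auto intro!: Ck_on_add)
  then show ?case using *
    by (auto intro!: exI[of _ "\<lambda>x v. h (f x) (g' x v) + h (f' x v) (g x)"] bounded_bilinear.FDERIV[OF h])
qed

lemma Ck_on_linear:
  assumes h: "bounded_linear h"
  shows "Ck_on k S f \<Longrightarrow> Ck_on k S (\<lambda>x. h (f x))"
proof (induction k arbitrary: f)
  case 0 then show ?case by (simp add: bounded_linear.continuous_on[OF h])
next
  case (Suc k)
  then obtain f' where
    "\<forall>x\<in>S. (f has_derivative f' x) (at x within S)" "\<forall>v. Ck_on k S (\<lambda>x. f' x v)"
    by auto
  then show ?case using Suc.IH
    by (auto intro!: exI[of _ "\<lambda>x v. h (f' x v)"] bounded_linear.has_derivative[OF h])
qed

lemma smooth_const: "smooth (\<lambda>_. c)"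
  by (simp add: smooth_def Ck_on_const)

lemma smooth_add: "smooth f \<Longrightarrow> smooth g \<Longrightarrow> smooth (\<lambda>x. f x + g x)"
  by (simp add: smooth_def Ck_on_add)

lemma smooth_bilinear: "bounded_bilinear h \<Longrightarrow> smooth f \<Longrightarrow> smooth g \<Longrightarrow> smooth (\<lambda>x. h (f x) (g x))"
  by (simp add: smooth_def Ck_on_bilinear)

lemma smooth_linear: "bounded_linear h \<Longrightarrow> smooth f \<Longrightarrow> smooth (\<lambda>x. h (f x))"
  by (simp add: smooth_def Ck_on_linear)

lemma smooth_sum: "finite I \<Longrightarrow> (\<And>i. i \<in> I \<Longrightarrow> smooth (f i)) \<Longrightarrow> smooth (\<lambda>x. \<Sum>i\<in>I. f i x)"
  by (induction I rule: finite_induct) (auto intro: smooth_const smooth_add)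

lemma smooth_id: "smooth (\<lambda>x. x)"
  unfolding smooth_def
proof
  fix k show "Ck_on k UNIV (\<lambda>x::'a. x)"
    by (cases k) (auto intro!: exI[of _ "\<lambda>_ v. v"] Ck_on_const has_derivative_ident)
qed

lemma smooth_has_derivative:
  "smooth f \<Longrightarrow> (f has_derivative frechet_derivative f (at x)) (at x)"
proof -
  assume "smooth f"
  then have "Ck_on 1 UNIV f" by (simp add: smooth_def)
  then have "f differentiable at x" by (auto simp: differentiable_def)
  then show ?thesis by (simp add: frechet_derivative_works)
qed

lemma smooth_frechet_derivative:
  assumes "smooth f" shows "smooth (\<lambda>x. frechet_derivative f (at x) v)"
  unfolding smooth_def
proof
  fix k
  have "Ck_on (Suc k) UNIV f" using assms by (simp add: smooth_def)
  then obtain f' where f': "\<forall>x. (f has_derivative f' x) (at x)" "\<forall>v. Ck_on k UNIV (\<lambda>x. f' x v)"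
    by auto
  then have "frechet_derivative f (at x) = f' x" for x
    by (simp add: frechet_derivative_at[symmetric])
  with f' show "Ck_on k UNIV (\<lambda>x. frechet_derivative f (at x) v)" by simp
qed

lemma ddir_basis:
  assumes "smooth f"
  shows "ddir X f p = (\<Sum>b\<in>Basis. (X p \<bullet> b) *\<^sub>R frechet_derivative f (at p) b)"
proof -
  interpret linear "frechet_derivative f (at p)"
    using smooth_has_derivative[OF assms] has_derivative_linear by blast
  have "frechet_derivative f (at p) (X p) = frechet_derivative f (at p) (\<Sum>b\<in>Basis. (X p \<bullet> b) *\<^sub>R b)"
    by (simp only: euclidean_representation)
  also have "\<dots> = (\<Sum>b\<in>Basis. (X p \<bullet> b) *\<^sub>R frechet_derivative f (at p) b)"
    by (simp add: sum scale)
  finally show ?thesis by (simp add: ddir_def)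
qed

lemma smooth_ddir:
  assumes "smooth X" "smooth f"
  shows "smooth (ddir X f)"
proof -
  have "smooth (\<lambda>p. \<Sum>b\<in>Basis. (X p \<bullet> b) *\<^sub>R frechet_derivative f (at p) b)"
    by (intro smooth_sum smooth_bilinear[OF bounded_bilinear_scaleR]
        smooth_linear[OF bounded_linear_inner_left] smooth_frechet_derivative assms finite_Basis)
  moreover have "ddir X f = (\<lambda>p. \<Sum>b\<in>Basis. (X p \<bullet> b) *\<^sub>R frechet_derivative f (at p) b)"
    using ddir_basis[OF assms(2)] by auto
  ultimately show ?thesis by simp
qed

lemma smooth_vec:
  fixes f :: "'i::finite \<Rightarrow> 'a::euclidean_space \<Rightarrow> real"
  assumes "\<And>i. smooth (f i)" shows "smooth (\<lambda>x. \<chi> i. f i x)"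
proof -
  have "smooth (\<lambda>x. \<Sum>i\<in>UNIV. f i x *\<^sub>R axis i 1 :: real^'i)"
    by (intro smooth_sum smooth_bilinear[OF bounded_bilinear_scaleR] smooth_const assms finite)
  also have "(\<lambda>x. \<Sum>i\<in>UNIV. f i x *\<^sub>R axis i 1 :: real^'i) = (\<lambda>x. \<chi> i. f i x)"
    by (auto simp: vec_eq_iff axis_def if_distrib cong: if_cong)
  finally show ?thesis .
qed

lemma smooth_Pair:
  assumes "smooth f" "smooth g" shows "smooth (\<lambda>x. (f x, g x))"
proof -
  have "smooth (\<lambda>x. (f x, 0) + (0, g x))"
    by (intro smooth_add smooth_linear[where h="\<lambda>x. (x, 0)"] smooth_linear[where h="\<lambda>x. (0, x)"]
      assms bounded_linear_Pair bounded_linear_ident bounded_linear_zero)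
  then show ?thesis by simp
qed


subsection \<open>A connection in the global chart\<close>

text \<open>\<open>nabla_at\<close> does not depend on the extension of the tangent vector, and \<open>cov_deriv\<close> agrees with
  the connection on restrictions of vector fields to the curve.\<close>

lemma affine_connectionD:
  assumes "affine_connection nabla"
  shows "smooth X \<Longrightarrow> smooth X' \<Longrightarrow> smooth Y \<Longrightarrow>
      nabla (\<lambda>p. X p + X' p) Y = (\<lambda>p. nabla X Y p + nabla X' Y p)"
    and "smooth f \<Longrightarrow> smooth X \<Longrightarrow> smooth Y \<Longrightarrow>
      nabla (\<lambda>p. f p *\<^sub>R X p) Y = (\<lambda>p. f p *\<^sub>R nabla X Y p)"
    and "smooth X \<Longrightarrow> smooth Y \<Longrightarrow> smooth Y' \<Longrightarrow>
      nabla X (\<lambda>p. Y p + Y' p) = (\<lambda>p. nabla X Y p + nabla X Y' p)"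
    and "smooth f \<Longrightarrow> smooth X \<Longrightarrow> smooth Y \<Longrightarrow>
      nabla X (\<lambda>p. f p *\<^sub>R Y p) = (\<lambda>p. ddir X f p *\<^sub>R Y p + f p *\<^sub>R nabla X Y p)"
  using assms unfolding affine_connection_def by simp_all

lemma affine_connection_sum_left:
  assumes "affine_connection nabla" "finite I" "\<And>i. i \<in> I \<Longrightarrow> smooth (X i)" "smooth Y"
  shows "nabla (\<lambda>p. \<Sum>i\<in>I. X i p) Y = (\<lambda>p. \<Sum>i\<in>I. nabla (X i) Y p)"
  using assms(2,3)
proof (induction I rule: finite_induct)
  case empty
  have "nabla (\<lambda>p. (\<lambda>_. 0) p *\<^sub>R (\<lambda>_. 0) p) Y = (\<lambda>p. (\<lambda>_. 0) p *\<^sub>R nabla (\<lambda>_. 0) Y p)"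
    by (rule affine_connectionD[OF assms(1)]) (intro smooth_const assms)+
  then show ?case by simp
next
  case (insert i I)
  have "nabla (\<lambda>p. X i p + (\<lambda>p. \<Sum>i\<in>I. X i p) p) Y = (\<lambda>p. nabla (X i) Y p + nabla (\<lambda>p. \<Sum>i\<in>I. X i p) Y p)"
    by (rule affine_connectionD(1)[OF assms(1)])
      (use insert.prems insert.hyps(1) assms(4) in \<open>auto intro: smooth_sum\<close>)
  then show ?case using insert by simp
qed

lemma affine_connection_sum_right:
  assumes "affine_connection nabla" "finite I" "\<And>i. i \<in> I \<Longrightarrow> smooth (Y i)" "smooth X"
  shows "nabla X (\<lambda>p. \<Sum>i\<in>I. Y i p) = (\<lambda>p. \<Sum>i\<in>I. nabla X (Y i) p)"
  using assms(2,3)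
proof (induction I rule: finite_induct)
  case empty
  have "nabla X (\<lambda>p. (\<lambda>_. 0) p *\<^sub>R (\<lambda>_. 0) p)
      = (\<lambda>p. ddir X (\<lambda>_. 0) p *\<^sub>R (\<lambda>_. 0) p + (\<lambda>_. 0) p *\<^sub>R nabla X (\<lambda>_. 0) p)"
    by (rule affine_connectionD[OF assms(1)]) (intro smooth_const assms)+
  then show ?case by simp
next
  case (insert i I)
  have "nabla X (\<lambda>p. Y i p + (\<lambda>p. \<Sum>i\<in>I. Y i p) p) = (\<lambda>p. nabla X (Y i) p + nabla X (\<lambda>p. \<Sum>i\<in>I. Y i p) p)"
    by (rule affine_connectionD(3)[OF assms(1)])
      (use insert.prems insert.hyps(1) assms(4) in \<open>auto intro: smooth_sum\<close>)
  then show ?case using insert by simp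
qed

lemma nabla_at_eq:
  assumes "affine_connection nabla" "smooth X" "smooth Y"
  shows "nabla X Y p = nabla_at nabla p (X p) Y"
proof -
  have sc: "smooth (\<lambda>p. X p \<bullet> b)" for b
    by (rule smooth_linear[OF bounded_linear_inner_left assms(2)])
  have *: "nabla (\<lambda>p. f p *\<^sub>R b) Y = (\<lambda>p. f p *\<^sub>R nabla (\<lambda>_. b) Y p)" if "smooth f" for f b
    by (rule affine_connectionD(2)[OF assms(1) that smooth_const assms(3)])
  have ss: "smooth (\<lambda>p. f p *\<^sub>R b)" if "smooth f" for f and b :: 'a
    by (rule smooth_bilinear[OF bounded_bilinear_scaleR that smooth_const])
  have 1: "nabla (\<lambda>q. \<Sum>b\<in>Basis. (X q \<bullet> b) *\<^sub>R b) Y p = (\<Sum>b\<in>Basis. (X p \<bullet> b) *\<^sub>R nabla (\<lambda>_. b) Y p)"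
    by (subst affine_connection_sum_left[OF assms(1)]) (auto intro!: ss sc assms simp: *[OF sc])
  have 2: "nabla (\<lambda>q. \<Sum>b\<in>Basis. (X p \<bullet> b) *\<^sub>R b) Y p = (\<Sum>b\<in>Basis. (X p \<bullet> b) *\<^sub>R nabla (\<lambda>_. b) Y p)"
    by (subst affine_connection_sum_left[OF assms(1)])
       (auto intro!: smooth_const assms simp: *[OF smooth_const])
  from 1 2 show ?thesis by (simp add: nabla_at_def euclidean_representation)
qed

lemma nabla_at_chart:
  assumes "affine_connection nabla" "smooth Y"
  shows "nabla_at nabla p v Y = frechet_derivative Y (at p) v + nabla_at nabla p v (\<lambda>_. Y p)"
proof -
  let ?X = "\<lambda>_::'a. v"
  have sc: "smooth (\<lambda>p. Y p \<bullet> b)" for b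
    by (rule smooth_linear[OF bounded_linear_inner_left assms(2)])
  have *: "nabla ?X (\<lambda>p. f p *\<^sub>R b) = (\<lambda>p. ddir ?X f p *\<^sub>R b + f p *\<^sub>R nabla ?X (\<lambda>_. b) p)" if "smooth f" for f b
  proof -
    have "nabla ?X (\<lambda>p. f p *\<^sub>R (\<lambda>_. b) p) = (\<lambda>p. ddir ?X f p *\<^sub>R (\<lambda>_. b) p + f p *\<^sub>R nabla ?X (\<lambda>_. b) p)"
      by (rule affine_connectionD(4)[OF assms(1) that smooth_const smooth_const])
    then show ?thesis by simp
  qed
  have ss: "smooth (\<lambda>p. f p *\<^sub>R b)" if "smooth f" for f and b :: 'a
    by (rule smooth_bilinear[OF bounded_bilinear_scaleR that smooth_const])
  have d: "ddir ?X (\<lambda>q. Y q \<bullet> b) p = ddir ?X Y p \<bullet> b" for b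
    unfolding ddir_def
    by (subst frechet_derivative_at[OF bounded_linear.has_derivative[OF bounded_linear_inner_left
      smooth_has_derivative[OF assms(2)]], symmetric]) simp
  have dc: "ddir ?X (\<lambda>q. c) p = 0" for c :: real
    by (simp add: ddir_def)
  have 1: "nabla ?X (\<lambda>q. \<Sum>b\<in>Basis. (Y q \<bullet> b) *\<^sub>R b) p
    = (\<Sum>b\<in>Basis. (ddir ?X Y p \<bullet> b) *\<^sub>R b + (Y p \<bullet> b) *\<^sub>R nabla ?X (\<lambda>_. b) p)"
    by (subst affine_connection_sum_right[OF assms(1)])
       (auto intro!: ss sc smooth_const simp: *[OF sc] d)
  have 2: "nabla ?X (\<lambda>q. \<Sum>b\<in>Basis. (Y p \<bullet> b) *\<^sub>R b) p
    = (\<Sum>b\<in>Basis. (Y p \<bullet> b) *\<^sub>R nabla ?X (\<lambda>_. b) p)"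
    by (subst affine_connection_sum_right[OF assms(1)])
       (auto intro!: ss smooth_const simp: *[OF smooth_const] dc)
  from 1 2 show ?thesis by (simp add: nabla_at_def euclidean_representation sum.distrib ddir_def)
qed

lemma cov_deriv_restriction:
  assumes "affine_connection nabla" "smooth Y" "a < b" "t \<in> {a..b}"
    and "\<gamma> differentiable (at t within {a..b})"
  shows "cov_deriv nabla a b \<gamma> (\<lambda>s. Y (\<gamma> s)) t = nabla_at nabla (\<gamma> t) (velocity a b \<gamma> t) Y"
proof -
  have "(\<gamma> has_vector_derivative velocity a b \<gamma> t) (at t within {a..b})"
    using assms(5) vector_derivative_works by blast
  then have "(Y \<circ> \<gamma> has_vector_derivative frechet_derivative Y (at (\<gamma> t)) (velocity a b \<gamma> t)) (at t within {a..b})"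
    by (rule vector_derivative_diff_chain_within)
      (rule has_derivative_at_withinI[OF smooth_has_derivative[OF assms(2)]])
  then have "velocity a b (\<lambda>s. Y (\<gamma> s)) t = frechet_derivative Y (at (\<gamma> t)) (velocity a b \<gamma> t)"
    using vector_derivative_within_closed_interval[OF assms(3,4)] by (simp add: o_def)
  then show ?thesis
    by (subst nabla_at_chart[OF assms(1,2)]) (simp add: cov_deriv_def)
qed


subsection \<open>The metric is Riemannian and has a Levi-Civita connection\<close>

lemma quat_skew: "u \<bullet> (quat r *v w) = - (w \<bullet> (quat r *v u))"
  using exhaust_3[of r] by (auto simp: quat_mult_vec inner_vec_def sum_4 vector_4)

definition h1_christoffel :: "h1 \<Rightarrow> h1 \<Rightarrow> h1 \<Rightarrow> h1" where
  "h1_christoffel p u w =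
     (let A = - (1/2) *\<^sub>R (\<Sum>r\<in>UNIV. z_coeff p u $ r *\<^sub>R (quat r *v fst w) + z_coeff p w $ r *\<^sub>R (quat r *v fst u))
      in (A, \<chi> r. 1/2 * (A \<bullet> (quat r *v fst p))))"

lemma z_coeff_christoffel: "z_coeff p (h1_christoffel p u w) = 0"
  by (simp add: z_coeff_def h1_christoffel_def Let_def vec_eq_iff)

lemma linear_z_coeff: "linear (z_coeff p)"
  by (rule linearI) (auto simp: z_coeff_def vec_eq_iff inner_add_left algebra_simps)

lemma smooth_nth: "smooth f \<Longrightarrow> smooth (\<lambda>x. f x $ i :: real)"
  by (rule smooth_linear[OF bounded_linear_vec_nth])

lemma smooth_real_mult: "smooth f \<Longrightarrow> smooth g \<Longrightarrow> smooth (\<lambda>x. f x * g x :: real)"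
  by (rule smooth_bilinear[OF bounded_bilinear_mult])

lemma smooth_inner: "smooth f \<Longrightarrow> smooth g \<Longrightarrow> smooth (\<lambda>x. f x \<bullet> g x)"
  by (rule smooth_bilinear[OF bounded_bilinear_inner])

lemma smooth_scaleR: "smooth f \<Longrightarrow> smooth g \<Longrightarrow> smooth (\<lambda>x. f x *\<^sub>R g x)"
  by (rule smooth_bilinear[OF bounded_bilinear_scaleR])

lemma smooth_matvec: "smooth f \<Longrightarrow> smooth (\<lambda>x. (A::real^'n^'m) *v f x)"
  by (rule smooth_linear[OF matrix_vector_mul_bounded_linear])

lemma smooth_fst: "smooth f \<Longrightarrow> smooth (\<lambda>x. fst (f x))"
  by (rule smooth_linear[OF bounded_linear_fst])

lemma smooth_snd: "smooth f \<Longrightarrow> smooth (\<lambda>x. snd (f x))"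
  by (rule smooth_linear[OF bounded_linear_snd])

lemma smooth_uminus: "smooth f \<Longrightarrow> smooth (\<lambda>x. - f x)"
  by (rule smooth_linear[OF bounded_linear_minus[OF bounded_linear_ident]])

lemma smooth_diff: "smooth f \<Longrightarrow> smooth g \<Longrightarrow> smooth (\<lambda>x. f x - g x)"
  using smooth_add[of f "\<lambda>x. - g x"] smooth_uminus[of g] by simp

lemmas smooth_intros = smooth_const smooth_id smooth_add smooth_diff smooth_uminus smooth_sum smooth_vec
  smooth_Pair smooth_nth smooth_real_mult smooth_inner smooth_scaleR smooth_matvec smooth_fst smooth_snd

lemma smooth_z_coeff: "smooth Y \<Longrightarrow> smooth (\<lambda>p. z_coeff p (Y p))"
  unfolding z_coeff_def by (intro smooth_intros)

lemma riemannian_metric_h1: "riemannian_metric h1_metric"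
  unfolding riemannian_metric_def
proof (intro conjI allI impI)
  fix p u v :: h1
  interpret z: linear "z_coeff p" by (rule linear_z_coeff)
  show "bilinear (h1_metric p)"
    unfolding bilinear_def
    by (intro conjI allI linearI) (auto simp: h1_metric_def z.add z.scale inner_simps algebra_simps)
  show "h1_metric p u v = h1_metric p v u"
    by (simp add: h1_metric_def inner_commute)
  show "smooth (\<lambda>p. h1_metric p u v)"
    unfolding h1_metric_def by (intro smooth_intros smooth_z_coeff)
  assume "u \<noteq> 0"
  show "h1_metric p u u > 0"
  proof (cases "fst u = 0")
    case True
    have "snd u \<noteq> 0" using True \<open>u \<noteq> 0\<close> by (auto simp: prod_eq_iff)
    moreover have "z_coeff p u = snd u" by (simp add: z_coeff_def True vec_eq_iff)
    ultimately
    show ?thesis by (simp add: h1_metric_def True)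
  next
    case False
    then show ?thesis by (simp add: h1_metric_def add_pos_nonneg)
  qed
qed


lemma has_derivative_z_coeff:
  assumes "(Y has_derivative Y') (at p)"
  shows "((\<lambda>q. z_coeff q (Y q)) has_derivative
    (\<lambda>v. z_coeff p (Y' v) - (\<chi> r. 1/2 * (fst (Y p) \<bullet> (quat r *v fst v))))) (at p)"
proof -
  define B :: "real^4 \<Rightarrow> real^4 \<Rightarrow> real^3" where "B = (\<lambda>u x. \<chi> r. 1/2 * (u \<bullet> (quat r *v x)))"
  have "bilinear B"
    unfolding bilinear_def B_def
    by (intro conjI allI linearI)
      (auto simp: vec_eq_iff inner_simps matrix_vector_right_distrib matrix_vector_mult_scaleR algebra_simps)
  then have B: "bounded_bilinear B" by (simp add: bilinear_conv_bounded_bilinear)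
  have z: "z_coeff q v = snd v - B (fst v) (fst q)" for q v
    by (simp add: z_coeff_def B_def vec_eq_iff)
  have "((\<lambda>q. snd (Y q) - B (fst (Y q)) (fst q)) has_derivative
     (\<lambda>v. snd (Y' v) - (B (fst (Y p)) (fst v) + B (fst (Y' v)) (fst p)))) (at p)"
    by (intro has_derivative_diff has_derivative_snd has_derivative_fst assms
       bounded_bilinear.FDERIV[OF B] has_derivative_ident)
  then show ?thesis
    by (simp add: z B_def diff_diff_eq add.commute)
qed

definition h1_nabla :: "(h1 \<Rightarrow> h1) \<Rightarrow> (h1 \<Rightarrow> h1) \<Rightarrow> h1 \<Rightarrow> h1" where
  "h1_nabla X Y p = ddir X Y p + h1_christoffel p (X p) (Y p)"

lemma ddir_metric:
  assumes "smooth Y" "smooth W"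
  shows "ddir X (\<lambda>q. h1_metric q (Y q) (W q)) p =
    h1_metric p (ddir X Y p) (W p) + h1_metric p (Y p) (ddir X W p)
    - 1/2 * (\<Sum>r\<in>UNIV. (fst (Y p) \<bullet> (quat r *v fst (X p))) * z_coeff p (W p) $ r
        + (fst (W p) \<bullet> (quat r *v fst (X p))) * z_coeff p (Y p) $ r)"
proof -
  let ?Y = "frechet_derivative Y (at p)" and ?W = "frechet_derivative W (at p)"
  note Y = smooth_has_derivative[OF assms(1), of p] and W = smooth_has_derivative[OF assms(2), of p]
  have "((\<lambda>q. h1_metric q (Y q) (W q)) has_derivative
     (\<lambda>v. (fst (Y p) \<bullet> fst (?W v) + fst (?Y v) \<bullet> fst (W p)) +
       (z_coeff p (Y p) \<bullet> (z_coeff p (?W v) - (\<chi> r. 1/2 * (fst (W p) \<bullet> (quat r *v fst v)))) +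
        (z_coeff p (?Y v) - (\<chi> r. 1/2 * (fst (Y p) \<bullet> (quat r *v fst v)))) \<bullet> z_coeff p (W p)))) (at p)"
    unfolding h1_metric_def
    by (intro has_derivative_add has_derivative_inner has_derivative_fst has_derivative_z_coeff Y W)
  from frechet_derivative_at[OF this, symmetric] have "ddir X (\<lambda>q. h1_metric q (Y q) (W q)) p =
     (\<lambda>v. (fst (Y p) \<bullet> fst (?W v) + fst (?Y v) \<bullet> fst (W p)) +
       (z_coeff p (Y p) \<bullet> (z_coeff p (?W v) - (\<chi> r. 1/2 * (fst (W p) \<bullet> (quat r *v fst v)))) +
        (z_coeff p (?Y v) - (\<chi> r. 1/2 * (fst (Y p) \<bullet> (quat r *v fst v)))) \<bullet> z_coeff p (W p))) (X p)"
    unfolding ddir_def by (rule fun_cong)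
  then show ?thesis
    by (simp add: ddir_def h1_metric_def inner_vec_def sum_3 field_simps)
qed

lemma christoffel_metric:
  "h1_metric p (h1_christoffel p x y) w + h1_metric p y (h1_christoffel p x w) =
   - 1/2 * (\<Sum>r\<in>UNIV. (fst y \<bullet> (quat r *v fst x)) * z_coeff p w $ r
        + (fst w \<bullet> (quat r *v fst x)) * z_coeff p y $ r)"
proof -
  have f: "fst (h1_christoffel p u w) = - (1/2) *\<^sub>R (\<Sum>r\<in>UNIV. z_coeff p u $ r *\<^sub>R (quat r *v fst w) + z_coeff p w $ r *\<^sub>R (quat r *v fst u))" for u w
    by (simp add: h1_christoffel_def Let_def)
  have s: "(quat r *v fst y) \<bullet> fst w = - ((quat r *v fst w) \<bullet> fst y)" for r
    using quat_skew[of "fst w" r "fst y"] by (simp add: inner_commute)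
  show ?thesis
    unfolding h1_metric_def z_coeff_christoffel f
    by (simp add: inner_simps inner_commute[of "fst y"] inner_commute[of "fst w"] sum_3 s algebra_simps)
qed

lemma christoffel_sym: "h1_christoffel p u w = h1_christoffel p w u"
  by (simp add: h1_christoffel_def add.commute)

lemma bilinear_christoffel: "bilinear (h1_christoffel p)"
proof -
  interpret z: linear "z_coeff p" by (rule linear_z_coeff)
  have "linear (h1_christoffel p u)" for u
  proof -
    let ?A = "\<lambda>w. - (1/2) *\<^sub>R (\<Sum>r\<in>UNIV. z_coeff p u $ r *\<^sub>R (quat r *v fst w)
      + z_coeff p w $ r *\<^sub>R (quat r *v fst u))"
    let ?L = "\<lambda>A::real^4. (A, \<chi> r. 1/2 * (A \<bullet> (quat r *v fst p)))"
    have "linear ?A"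
      by (rule linearI) (simp_all add: z.add z.scale sum_3 matrix_vector_right_distrib
        matrix_vector_mult_scaleR algebra_simps)
    moreover have "linear ?L"
      by (rule linearI) (simp_all add: vec_eq_iff inner_simps algebra_simps)
    ultimately have "linear (?L \<circ> ?A)" by (rule linear_compose)
    also have "?L \<circ> ?A = h1_christoffel p u" by (simp add: fun_eq_iff h1_christoffel_def Let_def)
    finally show ?thesis .
  qed
  moreover have "(\<lambda>u. h1_christoffel p u w) = h1_christoffel p w" for w
    by (rule ext) (rule christoffel_sym)
  ultimately show ?thesis by (simp add: bilinear_def)
qed

lemma smooth_christoffel: "smooth X \<Longrightarrow> smooth Y \<Longrightarrow> smooth (\<lambda>p. h1_christoffel p (X p) (Y p))"
  unfolding h1_christoffel_def Let_def by (intro smooth_intros smooth_z_coeff finite)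

lemma levi_civita_h1: "levi_civita h1_metric h1_nabla"
proof -
  note bl = bilinear_ladd[OF bilinear_christoffel] bilinear_radd[OF bilinear_christoffel]
    bilinear_lmul[OF bilinear_christoffel] bilinear_rmul[OF bilinear_christoffel]
  have lin: "linear (frechet_derivative Y (at p))" if "smooth Y" for Y :: "h1 \<Rightarrow> h1" and p
    using smooth_has_derivative[OF that] has_derivative_linear by blast
  have "affine_connection h1_nabla"
    unfolding affine_connection_def
  proof (intro conjI allI impI)
    fix X Y :: "h1 \<Rightarrow> h1" assume "smooth X" "smooth Y"
    then show "smooth (h1_nabla X Y)"
      unfolding h1_nabla_def by (intro smooth_add smooth_ddir smooth_christoffel)
  next
    fix X X' Y :: "h1 \<Rightarrow> h1" assume "smooth Y"
    then show "h1_nabla (\<lambda>p. X p + X' p) Y = (\<lambda>p. h1_nabla X Y p + h1_nabla X' Y p)"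
      by (auto simp: h1_nabla_def ddir_def linear_add[OF lin] bl)
  next
    fix f and X Y :: "h1 \<Rightarrow> h1" assume "smooth Y"
    then show "h1_nabla (\<lambda>p. f p *\<^sub>R X p) Y = (\<lambda>p. f p *\<^sub>R h1_nabla X Y p)"
      by (auto simp: h1_nabla_def ddir_def linear_scale[OF lin] bl scaleR_add_right)
  next
    fix X Y Y' :: "h1 \<Rightarrow> h1" assume Y: "smooth Y" "smooth Y'"
    have "ddir X (\<lambda>p. Y p + Y' p) p = ddir X Y p + ddir X Y' p" for p
      unfolding ddir_def
      by (simp add: frechet_derivative_at[OF has_derivative_add[OF Y[THEN smooth_has_derivative]], symmetric])
    then show "h1_nabla X (\<lambda>p. Y p + Y' p) = (\<lambda>p. h1_nabla X Y p + h1_nabla X Y' p)"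
      by (auto simp: h1_nabla_def bl)
  next
    fix f :: "h1 \<Rightarrow> real" and X Y :: "h1 \<Rightarrow> h1" assume f: "smooth f" "smooth Y"
    have "ddir X (\<lambda>p. f p *\<^sub>R Y p) p = f p *\<^sub>R ddir X Y p + ddir X f p *\<^sub>R Y p" for p
      unfolding ddir_def
      by (simp add: frechet_derivative_at[OF has_derivative_scaleR[OF f[THEN smooth_has_derivative]], symmetric])
    then show "h1_nabla X (\<lambda>p. f p *\<^sub>R Y p)
        = (\<lambda>p. ddir X f p *\<^sub>R Y p + f p *\<^sub>R h1_nabla X Y p)"
      by (auto simp: h1_nabla_def bl scaleR_add_right)
  qed
  moreover have "ddir X (\<lambda>q. h1_metric q (Y q) (W q)) p
      = h1_metric p (h1_nabla X Y p) (W p) + h1_metric p (Y p) (h1_nabla X W p)"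
    if "smooth Y" "smooth W" for X Y W p
  proof -
    have b: "bilinear (h1_metric p)"
      using riemannian_metric_h1 unfolding riemannian_metric_def by blast
    show ?thesis
      using christoffel_metric[of p "X p" "Y p" "W p"]
      by (simp add: ddir_metric[OF that] h1_nabla_def bilinear_ladd[OF b] bilinear_radd[OF b])
  qed
  moreover have "h1_nabla X Y p - h1_nabla Y X p = lie_bracket X Y p" for X Y p
    by (simp add: h1_nabla_def lie_bracket_def christoffel_sym[of p "Y p"])
  ultimately show ?thesis by (simp add: levi_civita_def)
qed

end

theory Submission
  imports Defs
begin

text \<open>Let \<open>quat_form u w\<close> be the skew \<open>\<real>\<^sup>3\<close>-valued form with components \<open>u \<bullet> (quat r *v w)\<close>. A curve
  \<open>(x, z)\<close> is horizontal iff \<open>z' = quat_form x' x / 2\<close>, and the differential equation says that \<open>x''\<close>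
  is a fixed linear combination of the \<open>quat r *v x'\<close>. An admissible variation with variation field \<open>y\<close>
  of \<open>x\<close> satisfies \<open>\<integral> quat_form y x' = 0\<close>, because the end point of \<open>z\<close> is fixed, and changes the length
  at the rate \<open>- \<integral> y \<bullet> x''\<close>. The equation makes this rate vanish. Conversely, any field \<open>\<psi> d\<close> with \<open>\<psi>\<close>
  vanishing at the end points becomes admissible after a correction along a fixed profile \<open>\<phi>\<close> with
  \<open>\<integral> \<phi> x' \<noteq> 0\<close>. The correction depends on \<open>\<psi> d\<close> only through \<open>\<integral> quat_form (\<psi> d) x'\<close>, which yields
  multipliers independent of \<open>\<psi>\<close> and \<open>d\<close>, and the fundamental lemma of the calculus of variations
  gives the equation.\<close>


section \<open>Functions of class C^k of one variable\<close>

text \<open>A linear map on \<open>real\<close> is determined by its value at 1, so the family of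
  directional derivatives in \<open>Ck_on\<close> reduces to a single vector-valued
  derivative.\<close>

lemma Ck_on_Suc_real:
  fixes f :: "real \<Rightarrow> 'b::real_normed_vector"
  shows "Ck_on (Suc k) S f \<longleftrightarrow>
    (\<exists>f'. (\<forall>t\<in>S. (f has_vector_derivative f' t) (at t within S)) \<and> Ck_on k S f')"
proof
  assume "Ck_on (Suc k) S f"
  then obtain F where F: "\<forall>t\<in>S. (f has_derivative F t) (at t within S)" "\<forall>v. Ck_on k S (\<lambda>t. F t v)"
    by auto
  have "(f has_vector_derivative F t 1) (at t within S)" if "t \<in> S" for t
  proof -
    have "F t = (\<lambda>h. h *\<^sub>R F t 1)"
    proof
      fix h :: real
      have "linear (F t)" using F(1) that has_derivative_linear by blast
      from linear_scale[OF this, of h 1] show "F t h = h *\<^sub>R F t 1" by simp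
    qed
    then show ?thesis using F(1) that by (simp add: has_vector_derivative_def)
  qed
  with F(2) show "\<exists>f'. (\<forall>t\<in>S. (f has_vector_derivative f' t) (at t within S)) \<and> Ck_on k S f'"
    by (intro exI[of _ "\<lambda>t. F t 1"]) simp
next
  assume "\<exists>f'. (\<forall>t\<in>S. (f has_vector_derivative f' t) (at t within S)) \<and> Ck_on k S f'"
  then obtain f' where "\<forall>t\<in>S. (f has_vector_derivative f' t) (at t within S)" "Ck_on k S f'" by blast
  then show "Ck_on (Suc k) S f"
    by (auto simp: has_vector_derivative_def
        intro!: exI[of _ "\<lambda>t h. h *\<^sub>R f' t"] Ck_on_linear[OF bounded_linear_scaleR_right])
qed

lemma Ck_on_2_realI:
  fixes f :: "real \<Rightarrow> 'b::real_normed_vector"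
  assumes "\<And>t. t \<in> S \<Longrightarrow> (f has_vector_derivative f' t) (at t within S)"
    and "\<And>t. t \<in> S \<Longrightarrow> (f' has_vector_derivative f'' t) (at t within S)" and "continuous_on S f''"
  shows "Ck_on 2 S f"
proof -
  have "Ck_on (Suc 0) S f'" unfolding Ck_on_Suc_real using assms by auto
  then have "Ck_on (Suc (Suc 0)) S f" using assms(1) by (subst Ck_on_Suc_real) blast
  then show ?thesis by (simp add: numeral_2_eq_2)
qed

lemma Ck_on_2_realE:
  fixes f :: "real \<Rightarrow> 'b::real_normed_vector"
  assumes "Ck_on 2 S f"
  obtains f' f'' where "\<And>t. t \<in> S \<Longrightarrow> (f has_vector_derivative f' t) (at t within S)"
    and "\<And>t. t \<in> S \<Longrightarrow> (f' has_vector_derivative f'' t) (at t within S)" and "continuous_on S f''"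
proof -
  have "Ck_on (Suc (Suc 0)) S f" using assms by (simp add: numeral_2_eq_2)
  then obtain f' where 1: "\<forall>t\<in>S. (f has_vector_derivative f' t) (at t within S)" "Ck_on (Suc 0) S f'"
    unfolding Ck_on_Suc_real by blast
  then obtain f'' where "\<forall>t\<in>S. (f' has_vector_derivative f'' t) (at t within S)" "Ck_on 0 S f''"
    unfolding Ck_on_Suc_real[of 0] by blast
  with 1 that[of f' f''] show thesis by simp
qed

section \<open>Closure of \<open>Ck_on\<close> under linear substitution, pairing, sums and
  inverses\<close>

lemma Ck_on_compose_linear:
  assumes h: "bounded_linear h" and sub: "h ` T \<subseteq> S"
  shows "Ck_on k S f \<Longrightarrow> Ck_on k T (\<lambda>x. f (h x))"
proof (induction k arbitrary: f)
  case 0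
  then show ?case
    using continuous_on_compose2[of S f T h] bounded_linear.continuous_on[OF h continuous_on_id] sub by simp
next
  case (Suc k)
  then obtain f' where f': "\<forall>x\<in>S. (f has_derivative f' x) (at x within S)" "\<forall>v. Ck_on k S (\<lambda>x. f' x v)"
    by auto
  have "((\<lambda>x. f (h x)) has_derivative (\<lambda>v. f' (h x) (h v))) (at x within T)" if "x \<in> T" for x
    using f'(1) sub that
    by (intro has_derivative_in_compose2[of S f f' h]) (auto intro: bounded_linear_imp_has_derivative[OF h])
  then show ?case using f'(2) Suc.IH by (auto intro!: exI[of _ "\<lambda>x v. f' (h x) (h v)"])
qed

lemma Ck_on_ident: "Ck_on k S (\<lambda>x. x)"
  by (cases k) (auto intro!: exI[of _ "\<lambda>_ v. v"] Ck_on_const has_derivative_ident)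

lemma Ck_on_Pair:
  assumes "Ck_on k S f" "Ck_on k S g" shows "Ck_on k S (\<lambda>x. (f x, g x))"
proof -
  have "Ck_on k S (\<lambda>x. (f x, 0) + (0, g x))"
    by (intro Ck_on_add Ck_on_linear[where h="\<lambda>x. (x, 0)"] Ck_on_linear[where h="\<lambda>x. (0, x)"]
      assms bounded_linear_Pair bounded_linear_ident bounded_linear_zero)
  then show ?thesis by simp
qed

lemma Ck_on_sum:
  "finite I \<Longrightarrow> (\<And>i. i \<in> I \<Longrightarrow> Ck_on k S (f i)) \<Longrightarrow> Ck_on k S (\<lambda>x. \<Sum>i\<in>I. f i x)"
  by (induction I rule: finite_induct) (auto intro: Ck_on_const Ck_on_add)

lemma Ck_on_uminus: "Ck_on k S f \<Longrightarrow> Ck_on k S (\<lambda>x. - f x)"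
  by (rule Ck_on_linear[OF bounded_linear_minus[OF bounded_linear_ident]])

lemma Ck_on_diff: "Ck_on k S f \<Longrightarrow> Ck_on k S g \<Longrightarrow> Ck_on k S (\<lambda>x. f x - g x)"
  using Ck_on_add[of k S f "\<lambda>x. - g x"] Ck_on_uminus[of k S g] by simp

lemmas Ck_on_scaleR = Ck_on_bilinear[OF bounded_bilinear_scaleR]

text \<open>The derivative of \<open>inverse (f x)\<close> is a product of \<open>f' x v\<close>
  with two copies of \<open>inverse (f x)\<close>, so the induction hypothesis covers every
  factor.\<close>

lemma Ck_on_inverse:
  fixes f :: "'a::euclidean_space \<Rightarrow> real"
  assumes nz: "\<And>x. x \<in> S \<Longrightarrow> f x \<noteq> 0"
  shows "Ck_on k S f \<Longrightarrow> Ck_on k S (\<lambda>x. inverse (f x))"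
proof (induction k)
  case 0 then show ?case using nz by (auto intro: continuous_on_inverse)
next
  case (Suc k)
  then obtain f' where f': "\<forall>x\<in>S. (f has_derivative f' x) (at x within S)" "\<forall>v. Ck_on k S (\<lambda>x. f' x v)"
    by auto
  have "Ck_on k S (\<lambda>x. inverse (f x))" using Suc Ck_on_Suc_D by blast
  then have "\<forall>v. Ck_on k S (\<lambda>x. - (inverse (f x) * f' x v * inverse (f x)))"
    using f'(2) by (intro allI Ck_on_uminus Ck_on_bilinear[OF bounded_bilinear_mult]) auto
  with f' nz show ?case
    by (auto intro!: exI[of _ "\<lambda>x v. - (inverse (f x) * f' x v * inverse (f x))"] has_derivative_inverse)
qed


section \<open>Integration by parts and the fundamental lemma\<close>

text \<open>The boundary terms vanish because \<open>f\<close> is zero at both ends. A general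
  bilinear \<open>h\<close> serves both uses: the inner product in the rate of change of length, and
  \<open>quat_form\<close> in the end point constraint.\<close>

lemma integral_by_parts_vanishing:
  fixes f :: "real \<Rightarrow> 'a::real_normed_vector" and g :: "real \<Rightarrow> 'b::real_normed_vector"
    and h :: "'a \<Rightarrow> 'b \<Rightarrow> 'c::banach"
  assumes h: "bounded_bilinear h" and "a \<le> b" and f0: "f a = 0" "f b = 0"
    and f: "\<And>t. t \<in> {a..b} \<Longrightarrow> (f has_vector_derivative f' t) (at t within {a..b})"
    and g: "\<And>t. t \<in> {a..b} \<Longrightarrow> (g has_vector_derivative g' t) (at t within {a..b})"
    and f'c: "continuous_on {a..b} f'" and g'c: "continuous_on {a..b} g'"
  shows "integral {a..b} (\<lambda>t. h (f' t) (g t)) = - integral {a..b} (\<lambda>t. h (f t) (g' t))"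
proof -
  interpret h: bounded_bilinear h by (rule h)
  have fc: "continuous_on {a..b} f" and gc: "continuous_on {a..b} g"
    using f g by (blast intro: continuous_on_vector_derivative)+
  have "((\<lambda>t. h (f t) (g' t) + h (f' t) (g t)) has_integral h (f b) (g b) - h (f a) (g a)) {a..b}"
    by (intro fundamental_theorem_of_calculus \<open>a \<le> b\<close> h.has_vector_derivative f g)
  then have "integral {a..b} (\<lambda>t. h (f t) (g' t) + h (f' t) (g t)) = 0"
    by (simp add: f0 h.zero_left integral_unique)
  moreover have "integral {a..b} (\<lambda>t. h (f t) (g' t) + h (f' t) (g t)) =
      integral {a..b} (\<lambda>t. h (f t) (g' t)) + integral {a..b} (\<lambda>t. h (f' t) (g t))"
    by (intro Henstock_Kurzweil_Integration.integral_add integrable_continuous_real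
        h.continuous_on fc gc f'c g'c)
  ultimately show ?thesis by (simp add: add_eq_0_iff)
qed

text \<open>By Stone-Weierstrass \<open>h\<close> is uniformly close to a polynomial
  \<open>g\<close>, and for \<open>q t = (t - a) * (b - t)\<close> the product of \<open>q\<close>
  and \<open>g\<close> is an allowed test function. Hence the integral of
  \<open>q t * (h t * h t)\<close> is arbitrarily small, so it is zero. Polynomial test functions
  have polynomial derivatives, which makes the later perturbations explicit.\<close>

lemma fundamental_lemma_polynomial:
  fixes h :: "real \<Rightarrow> real"
  assumes "a < b" and h: "continuous_on {a..b} h"
    and orth: "\<And>\<psi>. real_polynomial_function \<psi> \<Longrightarrow> \<psi> a = 0 \<Longrightarrow> \<psi> b = 0 \<Longrightarrow>
      integral {a..b} (\<lambda>t. \<psi> t * h t) = 0"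
    and "t \<in> {a..b}"
  shows "h t = 0"
proof -
  define q where "q t = (t - a) * (b - t)" for t
  have q: "real_polynomial_function q"
    unfolding q_def
    by (intro real_polynomial_function.intros real_polynomial_function_diff bounded_linear_ident)
  have qc: "continuous_on S q" for S unfolding q_def by (intro continuous_intros)
  have q0: "q t \<ge> 0" if "t \<in> {a..b}" for t using that by (simp add: q_def)
  have qh: "(\<lambda>t. q t * (h t * h t)) integrable_on {a..b}"
    by (intro integrable_continuous_real continuous_intros qc h)
  let ?C = "integral {a..b} (\<lambda>t. q t * \<bar>h t\<bar>)"
  have C: "?C \<ge> 0"
    by (intro integral_nonneg integrable_continuous_real continuous_intros qc h) (simp add: q0)
  have bound: "\<bar>integral {a..b} (\<lambda>t. q t * (h t * h t))\<bar> \<le> e * ?C" if "e > 0" for e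
  proof -
    obtain g where g: "real_polynomial_function g" "\<And>t. t \<in> {a..b} \<Longrightarrow> \<bar>h t - g t\<bar> < e"
      using Stone_Weierstrass_real_polynomial_function[OF compact_Icc h \<open>e > 0\<close>] by blast
    have gc: "continuous_on {a..b} g"
      using continuous_real_polymonial_function[OF g(1)] by (simp add: continuous_at_imp_continuous_on)
    have "integral {a..b} (\<lambda>t. q t * g t * h t) = 0"
      by (rule orth) (use real_polynomial_function.intros(4)[OF q g(1)] in \<open>simp_all add: q_def\<close>)
    moreover have "integral {a..b} (\<lambda>t. q t * (h t * h t)) - integral {a..b} (\<lambda>t. q t * g t * h t)
        = integral {a..b} (\<lambda>t. q t * (h t * h t) - q t * g t * h t)"
      by (intro integral_diff[symmetric] qh integrable_continuous_real continuous_intros qc gc h)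
    ultimately have "\<bar>integral {a..b} (\<lambda>t. q t * (h t * h t))\<bar>
        = norm (integral {a..b} (\<lambda>t. q t * (h t * h t) - q t * g t * h t))" by simp
    also have "\<dots> \<le> integral {a..b} (\<lambda>t. e * (q t * \<bar>h t\<bar>))"
    proof (rule integral_norm_bound_integral)
      fix t assume t: "t \<in> {a..b}"
      have "norm (q t * (h t * h t) - q t * g t * h t) = \<bar>h t - g t\<bar> * (q t * \<bar>h t\<bar>)"
        using q0[OF t] by (simp add: abs_mult[symmetric] left_diff_distrib[symmetric]
            right_diff_distrib[symmetric] mult.assoc) (simp add: abs_mult)
      also have "\<dots> \<le> e * (q t * \<bar>h t\<bar>)"
        using g(2)[OF t] q0[OF t] by (intro mult_right_mono) auto
      finally show "norm (q t * (h t * h t) - q t * g t * h t) \<le> e * (q t * \<bar>h t\<bar>)" .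
    qed (intro integrable_continuous_real continuous_intros qc gc h)+
    finally show ?thesis by simp
  qed
  have "integral {a..b} (\<lambda>t. q t * (h t * h t)) = 0"
  proof (rule ccontr)
    assume I: "integral {a..b} (\<lambda>t. q t * (h t * h t)) \<noteq> 0"
    \<comment> \<open>With this \<open>e\<close> the absolute value of the integral equals
      \<open>e * (2 * (?C + 1))\<close>, which exceeds the bound \<open>e * ?C\<close>. The added 1
      keeps the denominator positive when \<open>?C\<close> is zero.\<close>
    define e where "e = \<bar>integral {a..b} (\<lambda>t. q t * (h t * h t))\<bar> / (2 * (?C + 1))"
    have "e > 0" using I C by (simp add: e_def)
    then have "\<bar>integral {a..b} (\<lambda>t. q t * (h t * h t))\<bar> \<le> e * ?C" by (rule bound)
    moreover have "\<bar>integral {a..b} (\<lambda>t. q t * (h t * h t))\<bar> = e * (2 * (?C + 1))"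
      using C by (simp add: e_def)
    ultimately have "e * (2 * (?C + 1)) \<le> e * ?C" by simp
    then show False using \<open>e > 0\<close> C by (simp add: mult_le_cancel_left_pos)
  qed
  moreover have "continuous_on {a..b} (\<lambda>t. q t * (h t * h t))" by (intro continuous_intros qc h)
  ultimately have z: "q t * (h t * h t) = 0" if "t \<in> {a..b}" for t
    using integral_eq_0_iff[of a b "\<lambda>t. q t * (h t * h t)"] that \<open>a < b\<close> q0 by simp
  \<comment> \<open>Since \<open>q\<close> vanishes at the end points, only interior values are
    obtained here; continuity of \<open>h\<close> extends them to the closed interval.\<close>
  have "h t = 0" if "t \<in> {a<..<b}" for t using z[of t] that by (auto simp: q_def)
  then show ?thesis
    using continuous_constant_on_closure[of "{a<..<b}" h 0 t] h assms(1,4) by simp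
qed

lemma fundamental_lemma_polynomial_vector:
  fixes f :: "real \<Rightarrow> 'a::euclidean_space"
  assumes "a < b" and f: "continuous_on {a..b} f"
    and orth: "\<And>\<psi>. real_polynomial_function \<psi> \<Longrightarrow> \<psi> a = 0 \<Longrightarrow> \<psi> b = 0 \<Longrightarrow>
      integral {a..b} (\<lambda>t. \<psi> t *\<^sub>R f t) = 0"
    and "t \<in> {a..b}"
  shows "f t = 0"
proof (rule euclidean_eqI)
  fix c :: 'a assume "c \<in> Basis"
  have "integral {a..b} (\<lambda>t. \<psi> t * (f t \<bullet> c)) = 0"
    if p: "real_polynomial_function \<psi>" "\<psi> a = 0" "\<psi> b = 0" for \<psi>
  proof -
    have "continuous_on {a..b} \<psi>"
      using continuous_real_polymonial_function[OF p(1)] by (simp add: continuous_at_imp_continuous_on)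
    then have "(\<lambda>t. \<psi> t *\<^sub>R f t) integrable_on {a..b}"
      by (intro integrable_continuous_real continuous_intros f)
    from integral_component_eq[OF this, of c] show ?thesis using orth[OF p] by simp
  qed
  then show "f t \<bullet> c = 0 \<bullet> c"
    using fundamental_lemma_polynomial[OF \<open>a < b\<close> continuous_on_inner[OF f continuous_on_const], of c t]
      \<open>t \<in> {a..b}\<close> by simp
qed


section \<open>Geometry of the group\<close>

text \<open>This is twice the bilinear term of the group law \<open>hmult\<close>. Bundling the
  three central components lets the rules for \<open>bounded_bilinear\<close> treat them at
  once.\<close>

definition quat_form :: "real^4 \<Rightarrow> real^4 \<Rightarrow> real^3" where
  "quat_form u w = (\<chi> r. u \<bullet> (quat r *v w))"

lemma bounded_bilinear_quat_form: "bounded_bilinear quat_form"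
proof -
  have "bilinear quat_form"
    unfolding bilinear_def quat_form_def
    by (intro conjI allI linearI)
      (auto simp: vec_eq_iff inner_simps matrix_vector_right_distrib matrix_vector_mult_scaleR)
  then show ?thesis by (simp add: bilinear_conv_bounded_bilinear)
qed

interpretation quat_form: bounded_bilinear quat_form
  by (rule bounded_bilinear_quat_form)

lemma quat_form_skew: "quat_form u w = - quat_form w u"
  by (simp add: quat_form_def vec_eq_iff quat_skew[of u _ w])

lemma quat_form_self [simp]: "quat_form u u = 0"
  using quat_skew[of u _ u] by (simp add: quat_form_def vec_eq_iff)

lemma quat_mult_inner:
  "(quat k *v u) \<bullet> (quat r *v u) = (if k = r then u \<bullet> u else 0)"
  using exhaust_3[of r] exhaust_3[of k]
  by (auto simp: quat_mult_vec inner_vec_def sum_4 vector_4)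

text \<open>Only the diagonal terms survive, by the orthogonality in \<open>quat_mult_inner\<close>.
  For nonzero \<open>u\<close> this gives an explicit right inverse of the map sending
  \<open>c\<close> to \<open>quat_form c u\<close>, with which a central end point can be
  corrected.\<close>

lemma quat_form_quat_mult: "quat_form (\<Sum>k\<in>UNIV. \<beta> $ k *\<^sub>R (quat k *v u)) u = (u \<bullet> u) *\<^sub>R \<beta>"
  by (simp add: quat_form_def vec_eq_iff inner_sum_left quat_mult_inner if_distrib cong: if_cong)

lemma z_coeff_eq_0_iff: "z_coeff p v = 0 \<longleftrightarrow> snd v = (1/2) *\<^sub>R quat_form (fst v) (fst p)"
  by (simp add: z_coeff_def quat_form_def vec_eq_iff)

lemma horizontal_space_iff: "v \<in> horizontal_space p \<longleftrightarrow> snd v = (1/2) *\<^sub>R quat_form (fst v) (fst p)"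
proof
  assume "v \<in> horizontal_space p"
  then have "z_coeff p v = 0"
    unfolding horizontal_space_def
  proof (rule span_induct)
    show "subspace {v. z_coeff p v = 0}"
      using linear_z_coeff[of p] by (simp add: subspace_def linear_0 linear_add linear_scale)
  qed (auto simp: z_coeff_def X_field_def vec_eq_iff inner_axis')
  then show "snd v = (1/2) *\<^sub>R quat_form (fst v) (fst p)" by (simp add: z_coeff_eq_0_iff)
next
  assume "snd v = (1/2) *\<^sub>R quat_form (fst v) (fst p)"
  then have "z_coeff p v = 0" by (simp add: z_coeff_eq_0_iff)
  then have v: "v = (\<Sum>i\<in>UNIV. fst v $ i *\<^sub>R X_field i p)"
    using h1_frame_expansion[of v p] by simp
  show "v \<in> horizontal_space p"
    unfolding horizontal_space_def by (subst v) (intro span_sum span_scale span_base rangeI)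
qed

text \<open>The difference of two Levi-Civita connections, paired with a third field by the metric, is
  symmetric in the first two arguments and skew in the last two, hence zero.\<close>

lemma levi_civita_unique:
  assumes g: "riemannian_metric g" and n: "levi_civita g nabla" "levi_civita g nabla'"
    and "smooth X" "smooth Y"
  shows "nabla X Y p = nabla' X Y p"
proof (rule ccontr)
  assume neq: "nabla X Y p \<noteq> nabla' X Y p"
  define D where "D X Y = nabla X Y p - nabla' X Y p" for X Y
  have b: "bilinear (g p)" and gs: "g p u v = g p v u" and gp: "u \<noteq> 0 \<Longrightarrow> g p u u > 0" for u v
    using g unfolding riemannian_metric_def by blast+
  have sym: "D X Y = D Y X" if "smooth X" "smooth Y" for X Y
  proof -
    have "nabla X Y p - nabla Y X p = nabla' X Y p - nabla' Y X p"
      using n that unfolding levi_civita_def by simp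
    then show ?thesis by (simp add: D_def algebra_simps)
  qed
  have compat: "ddir X (\<lambda>q. g q (Y q) (W q)) p = g p (N X Y p) (W p) + g p (Y p) (N X W p)"
    if "levi_civita g N" "smooth X" "smooth Y" "smooth W" for N X Y W
    using that unfolding levi_civita_def by blast
  have skew: "g p (D X Y) (W p) = - g p (D X W) (Y p)" if "smooth X" "smooth Y" "smooth W" for X Y W
  proof -
    have "g p (nabla X Y p) (W p) + g p (Y p) (nabla X W p)
        = g p (nabla' X Y p) (W p) + g p (Y p) (nabla' X W p)"
      using compat[OF n(1) that] compat[OF n(2) that] by simp
    then show ?thesis
      using gs[of "Y p"] by (simp add: D_def bilinear_lsub[OF b] algebra_simps)
  qed
  \<comment> \<open>The third field extends the value \<open>D X Y\<close> constantly. Three uses of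
    skewness alternating with three swaps then lead from \<open>g p (D X Y) (D X Y)\<close> to its
    own negative.\<close>
  define W where "W = (\<lambda>_::'a. D X Y)"
  have W: "smooth W" unfolding W_def by (rule smooth_const)
  note XY = \<open>smooth X\<close> \<open>smooth Y\<close>
  have "g p (D X Y) (W p) = - g p (D X Y) (W p)"
    using skew[OF XY W] sym[OF XY(1) W] skew[OF W XY(1) XY(2)] sym[OF W XY(2)] skew[OF XY(2) W XY(1)]
      sym[OF XY] by simp
  moreover have "D X Y \<noteq> 0" using neq by (simp add: D_def)
  ultimately show False using gp[of "D X Y"] by (simp add: W_def)
qed

section \<open>The connection, covariant derivatives and the maps \<open>J_map\<close> in the global
  chart\<close>

context
  fixes nabla assumes lc: "levi_civita h1_metric nabla"
begin

lemma nabla_at_h1: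
  assumes "smooth Y"
  shows "nabla_at nabla p v Y = frechet_derivative Y (at p) v + h1_christoffel p v (Y p)"
  unfolding nabla_at_def
  by (simp add: levi_civita_unique[OF riemannian_metric_h1 lc levi_civita_h1 smooth_const assms]
      h1_nabla_def ddir_def)

lemma cov_deriv_h1:
  "cov_deriv nabla a b \<gamma> V t = velocity a b V t + h1_christoffel (\<gamma> t) (velocity a b \<gamma> t) (V t)"
  by (simp add: cov_deriv_def nabla_at_h1[OF smooth_const])

text \<open>\<open>Z_field r\<close> is constant in the chart, so only the Christoffel term
  contributes, and half of it drops because \<open>v\<close> has no central frame coordinates. The
  minus sign reappears in the factor \<open>- 2 * lam r\<close> of the main theorem's proof.\<close>

lemma J_map_h1:
  assumes "z_coeff p v = 0"
  shows "J_map nabla r p v = - (quat r *v fst v, (1/2) *\<^sub>R quat_form (quat r *v fst v) (fst p))"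
proof -
  have Z: "Z_field r = (\<lambda>_. (0, axis r 1))" by (auto simp: Z_field_def)
  have "z_coeff p (0, axis r 1) = axis r 1" by (simp add: z_coeff_def vec_eq_iff)
  then have s: "(\<Sum>s\<in>UNIV. z_coeff p v $ s *\<^sub>R (quat s *v fst (0, axis r 1))
      + z_coeff p (0, axis r 1) $ s *\<^sub>R (quat s *v fst v)) = quat r *v fst v"
    by (simp add: assms axis_def if_distrib if_distribR cong: if_cong)
  show ?thesis
    unfolding J_map_def Z nabla_at_h1[OF smooth_const] h1_christoffel_def Let_def s
    by (simp add: quat_form_def vec_eq_iff)
qed

end

text \<open>Each summand of the Christoffel term carries a central frame coordinate of an argument.
  Consequently the covariant acceleration of a horizontal curve is its ordinary second derivative in
  the chart.\<close>

lemma christoffel_horizontal: "z_coeff p v = 0 \<Longrightarrow> h1_christoffel p v v = 0"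
  by (simp add: h1_christoffel_def zero_prod_def vec_eq_iff)


section \<open>The first variation of length\<close>

lemma has_vector_derivative_fst:
  "(f has_vector_derivative f') F \<Longrightarrow> ((\<lambda>t. fst (f t)) has_vector_derivative fst f') F"
  by (rule bounded_linear.has_vector_derivative[OF bounded_linear_fst])

lemma has_vector_derivative_snd:
  "(f has_vector_derivative f') F \<Longrightarrow> ((\<lambda>t. snd (f t)) has_vector_derivative snd f') F"
  by (rule bounded_linear.has_vector_derivative[OF bounded_linear_snd])

text \<open>This is the chain rule along a path \<open>l\<close> inside \<open>S\<close>. Applied to
  coordinate lines it yields partial derivatives, including one-sided ones at the ends of the
  parameter interval.\<close>

lemma has_vector_derivative_slice:
  assumes f: "(f has_derivative F) (at (l t) within S)" and l: "(l has_vector_derivative v) (at t within T)"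
    and "l ` T \<subseteq> S"
  shows "((\<lambda>t. f (l t)) has_vector_derivative F v) (at t within T)"
proof -
  have "(f has_derivative F) (at (l t) within l ` T)"
    using f \<open>l ` T \<subseteq> S\<close> by (rule has_derivative_subset)
  then have "(f \<circ> l has_derivative F \<circ> (\<lambda>h. h *\<^sub>R v)) (at t within T)"
    using l by (intro diff_chain_within) (auto simp: has_vector_derivative_def)
  moreover have "F (h *\<^sub>R v) = h *\<^sub>R F v" for h
    using linear_scale[OF has_derivative_linear[OF f]] .
  ultimately show ?thesis by (simp add: has_vector_derivative_def o_def)
qed

lemma continuous_on_slice:
  assumes "continuous_on (U \<times> S) (\<lambda>(\<epsilon>, s). f \<epsilon> s)" "\<epsilon> \<in> U"
  shows "continuous_on S (f \<epsilon>)"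
proof -
  have "continuous_on S (\<lambda>s. (\<lambda>(\<epsilon>, s). f \<epsilon> s) (\<epsilon>, s))"
    by (rule continuous_on_compose2[OF assms(1)]) (use assms(2) in \<open>auto intro: continuous_intros\<close>)
  then show ?thesis by simp
qed

text \<open>The norm is differentiable only away from 0. Uniform continuity on a compact product
  keeps \<open>u \<epsilon> s\<close> at distance less than 1 from the unit vector
  \<open>u 0 s\<close> for all small \<epsilon>, uniformly in \<open>s\<close>, hence nonzero. Then
  differentiation under the integral sign applies, and \<open>sgn (u 0 s)\<close> is
  \<open>u 0 s\<close>.\<close>

lemma norm_integral_has_derivative:
  fixes u w :: "real \<Rightarrow> real \<Rightarrow> 'a::euclidean_space"
  assumes U: "open U" "0 \<in> U"
    and uc: "continuous_on (U \<times> {a..b}) (\<lambda>(\<epsilon>, s). u \<epsilon> s)"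
    and wc: "continuous_on (U \<times> {a..b}) (\<lambda>(\<epsilon>, s). w \<epsilon> s)"
    and du: "\<And>\<epsilon> s. \<epsilon> \<in> U \<Longrightarrow> s \<in> {a..b} \<Longrightarrow> ((\<lambda>\<epsilon>. u \<epsilon> s) has_vector_derivative w \<epsilon> s) (at \<epsilon>)"
    and unit: "\<And>s. s \<in> {a..b} \<Longrightarrow> norm (u 0 s) = 1"
  shows "((\<lambda>\<epsilon>. integral {a..b} (\<lambda>s. norm (u \<epsilon> s))) has_real_derivative
    integral {a..b} (\<lambda>s. u 0 s \<bullet> w 0 s)) (at 0)"
proof -
  obtain e where e: "e > 0" "cball 0 e \<subseteq> U" using U open_contains_cball by blast
  have "uniformly_continuous_on (cball 0 e \<times> {a..b}) (\<lambda>(\<epsilon>, s). u \<epsilon> s)"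
    using e(2) by (intro compact_uniformly_continuous continuous_on_subset[OF uc] compact_Times) auto
  from this[unfolded uniformly_continuous_on_def, rule_format, OF zero_less_one]
  obtain d where d: "d > 0" "\<And>p q. p \<in> cball 0 e \<times> {a..b} \<Longrightarrow> q \<in> cball 0 e \<times> {a..b} \<Longrightarrow>
      dist q p < d \<Longrightarrow> dist (u (fst q) (snd q)) (u (fst p) (snd p)) < 1"
    by (auto simp: case_prod_unfold)
  define V where "V = ball (0::real) (min d e)"
  have V: "open V" "convex V" "0 \<in> V" "V \<subseteq> U" using e d by (auto simp: V_def)
  have nz: "u \<epsilon> s \<noteq> 0" if "\<epsilon> \<in> V" "s \<in> {a..b}" for \<epsilon> s
  proof
    assume "u \<epsilon> s = 0"
    then show False
      using d(2)[of "(0, s)" "(\<epsilon>, s)"] that e(1) unit[of s] by (auto simp: V_def dist_Pair_Pair dist_norm)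
  qed
  have uc': "continuous_on (V \<times> {a..b}) (\<lambda>(\<epsilon>, s). u \<epsilon> s)"
    and wc': "continuous_on (V \<times> {a..b}) (\<lambda>(\<epsilon>, s). w \<epsilon> s)"
    using V(4) by (auto intro: continuous_on_subset[OF uc] continuous_on_subset[OF wc])
  have us: "continuous_on {a..b} (u \<epsilon>)" if "\<epsilon> \<in> V" for \<epsilon>
    using uc' that by (rule continuous_on_slice)
  have "((\<lambda>\<epsilon>. integral (cbox a b) (\<lambda>s. norm (u \<epsilon> s))) has_real_derivative
    integral (cbox a b) (\<lambda>s. sgn (u 0 s) \<bullet> w 0 s)) (at 0 within V)"
  proof (rule leibniz_rule_field_derivative[OF _ _ _ V(3,2)])
    fix \<epsilon> s assume *: "\<epsilon> \<in> V" "s \<in> cbox a b"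
    then have "((\<lambda>\<epsilon>. u \<epsilon> s) has_derivative (\<lambda>h. h *\<^sub>R w \<epsilon> s)) (at \<epsilon> within V)"
      using du[of \<epsilon> s] V(4) by (auto simp: has_vector_derivative_def intro: has_derivative_at_withinI)
    from has_derivative_compose[OF this has_derivative_norm] nz[of \<epsilon> s] *
    show "((\<lambda>\<epsilon>. norm (u \<epsilon> s)) has_real_derivative sgn (u \<epsilon> s) \<bullet> w \<epsilon> s) (at \<epsilon> within V)"
      by (simp add: has_field_derivative_def mult_commute_abs inner_commute)
  next
    fix \<epsilon> assume "\<epsilon> \<in> V"
    then show "(\<lambda>s. norm (u \<epsilon> s)) integrable_on cbox a b"
      using us by (auto intro!: integrable_continuous_real continuous_intros)
  next
    show "continuous_on (V \<times> cbox a b) (\<lambda>(\<epsilon>, s). sgn (u \<epsilon> s) \<bullet> w \<epsilon> s)"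
      using uc' wc' nz by (auto simp: case_prod_unfold intro!: continuous_intros continuous_on_sgn)
  qed
  moreover have "sgn (u 0 s) = u 0 s" if "s \<in> {a..b}" for s
    using unit[OF that] by (simp add: sgn_div_norm)
  then have "integral {a..b} (\<lambda>s. sgn (u 0 s) \<bullet> w 0 s) = integral {a..b} (\<lambda>s. u 0 s \<bullet> w 0 s)"
    by (intro Henstock_Kurzweil_Integration.integral_cong) simp
  ultimately show ?thesis using at_within_open[OF V(3,1)] by simp
qed

text \<open>The curve is given by its components: \<open>x1\<close> and \<open>x2\<close> are the
  derivatives of \<open>x\<close>, and \<open>dz\<close> expresses horizontality. The metric length
  of a horizontal vector is the norm of its first component, so \<open>unit\<close> says that the
  parameter is arc length.\<close>

locale unit_horizontal_curve =
  fixes a b :: real and x x1 x2 :: "real \<Rightarrow> real^4" and z :: "real \<Rightarrow> real^3"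
  assumes ab: "a < b"
    and dx: "\<And>t. t \<in> {a..b} \<Longrightarrow> (x has_vector_derivative x1 t) (at t within {a..b})"
    and dx1: "\<And>t. t \<in> {a..b} \<Longrightarrow> (x1 has_vector_derivative x2 t) (at t within {a..b})"
    and dz: "\<And>t. t \<in> {a..b} \<Longrightarrow> (z has_vector_derivative (1/2) *\<^sub>R quat_form (x1 t) (x t)) (at t within {a..b})"
    and x2_cont: "continuous_on {a..b} x2"
    and unit: "\<And>t. t \<in> {a..b} \<Longrightarrow> norm (x1 t) = 1"
begin

abbreviation "curve \<equiv> \<lambda>t. (x t, z t)"

lemma x_cont: "continuous_on {a..b} x" and x1_cont: "continuous_on {a..b} x1"
  using dx dx1 by (blast intro: continuous_on_vector_derivative)+

text \<open>Differentiating \<open>x\<^sub>\<epsilon>(s) - x\<^sub>\<epsilon>(a) = \<integral> \<partial>\<^sub>s x\<^sub>\<epsilon>\<close> under the integral sign shows that the variation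
  field is a primitive of \<open>\<partial>\<^sub>\<epsilon> \<partial>\<^sub>s x\<^sub>\<epsilon>\<close>; this replaces the symmetry of second derivatives. The fixed
  end point of the central component gives the integral condition on the variation field.\<close>

lemma first_variation:
  assumes "admissible_variation a b curve U \<Gamma>"
  obtains y where "\<And>s. s \<in> {a..b} \<Longrightarrow> ((\<lambda>\<epsilon>. fst (\<Gamma> \<epsilon> s)) has_vector_derivative y s) (at 0)"
    and "continuous_on {a..b} y"
    and "integral {a..b} (\<lambda>s. quat_form (y s) (x1 s)) = 0"
    and "((\<lambda>\<epsilon>. curve_length a b (\<Gamma> \<epsilon>)) has_real_derivative
      - integral {a..b} (\<lambda>s. y s \<bullet> x2 s)) (at 0)"
proof -
  let ?S = "{a..b} \<times> U"
  have U: "open U" "is_interval U" "0 \<in> U" and C2: "Ck_on 2 ?S (\<lambda>p. \<Gamma> (snd p) (fst p))"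
    and \<Gamma>0: "\<And>s. s \<in> {a..b} \<Longrightarrow> \<Gamma> 0 s = (x s, z s)"
    and hor: "\<And>\<epsilon>. \<epsilon> \<in> U \<Longrightarrow> horizontal_curve a b (\<Gamma> \<epsilon>)"
    and ends: "\<And>\<epsilon>. \<epsilon> \<in> U \<Longrightarrow> \<Gamma> \<epsilon> a = (x a, z a)" "\<And>\<epsilon>. \<epsilon> \<in> U \<Longrightarrow> \<Gamma> \<epsilon> b = (x b, z b)"
    using assms unfolding admissible_variation_def variation_def by (auto simp: case_prod_unfold)
  have cU: "convex U" using U(2) by (rule is_interval_convex)
  obtain G where G: "\<And>p. p \<in> ?S \<Longrightarrow> ((\<lambda>p. \<Gamma> (snd p) (fst p)) has_derivative G p) (at p within ?S)"
    and G1: "\<And>v. Ck_on (Suc 0) ?S (\<lambda>p. G p v)"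
    using C2 unfolding numeral_2_eq_2 Ck_on.simps(2)[of "Suc 0"] by blast
  obtain H where H: "\<And>p. p \<in> ?S \<Longrightarrow> ((\<lambda>p. G p (1, 0)) has_derivative H p) (at p within ?S)"
    and H0: "\<And>v. continuous_on ?S (\<lambda>p. H p v)"
    using G1[of "(1, 0)"] by auto
  \<comment> \<open>The partial derivatives of the variation: \<open>u\<close> in \<open>s\<close>,
    \<open>g\<close> in \<epsilon>, and \<open>w\<close> is the \<epsilon>-derivative of
    \<open>u\<close>.\<close>
  define u where "u \<epsilon> s = G (s, \<epsilon>) (1, 0)" for \<epsilon> s
  define g where "g \<epsilon> s = G (s, \<epsilon>) (0, 1)" for \<epsilon> s
  define w where "w \<epsilon> s = H (s, \<epsilon>) (0, 1)" for \<epsilon> s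
  have swap: "continuous_on (U \<times> {a..b}) (\<lambda>(\<epsilon>, s). f (s, \<epsilon>))" if "continuous_on ?S f"
    for f :: "real \<times> real \<Rightarrow> h1"
  proof -
    have "continuous_on (U \<times> {a..b}) (\<lambda>p. f (snd p, fst p))"
      by (rule continuous_on_compose2[OF that])
        (auto intro!: continuous_on_Pair continuous_on_fst continuous_on_snd continuous_on_id)
    then show ?thesis by (simp add: case_prod_unfold)
  qed
  have cont: "continuous_on (U \<times> {a..b}) (\<lambda>(\<epsilon>, s). \<Gamma> \<epsilon> s)" "continuous_on (U \<times> {a..b}) (\<lambda>(\<epsilon>, s). u \<epsilon> s)"
    "continuous_on (U \<times> {a..b}) (\<lambda>(\<epsilon>, s). g \<epsilon> s)" "continuous_on (U \<times> {a..b}) (\<lambda>(\<epsilon>, s). w \<epsilon> s)"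
    unfolding u_def g_def w_def
    using swap[of "\<lambda>p. \<Gamma> (snd p) (fst p)"] swap[of "\<lambda>p. G p (1, 0)"] swap[of "\<lambda>p. G p (0, 1)"]
      swap[OF H0[of "(0, 1)"]] Ck_on_Suc_D[OF G1[of "(1, 0)"]] Ck_on_Suc_D[OF G1[of "(0, 1)"]]
      Ck_on_Suc_D[OF Ck_on_Suc_D[of "Suc 0" ?S "\<lambda>p. \<Gamma> (snd p) (fst p)"]] C2
    by (simp_all add: numeral_2_eq_2)
  have ds: "(\<Gamma> \<epsilon> has_vector_derivative u \<epsilon> s) (at s within {a..b})" if "\<epsilon> \<in> U" "s \<in> {a..b}" for \<epsilon> s
  proof -
    have "((\<lambda>s. (s, \<epsilon>)) has_vector_derivative (1, 0)) (at s within {a..b})"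
      by (intro has_vector_derivative_Pair has_vector_derivative_id has_vector_derivative_const)
    from has_vector_derivative_slice[OF G this] that show ?thesis by (simp add: u_def image_subset_iff)
  qed
  have ep: "((\<lambda>\<epsilon>. (s, \<epsilon>)) has_vector_derivative (0, 1)) (at \<epsilon> within U)" for s \<epsilon> :: real
    by (intro has_vector_derivative_Pair has_vector_derivative_id has_vector_derivative_const)
  have dg: "((\<lambda>\<epsilon>. \<Gamma> \<epsilon> s) has_vector_derivative g \<epsilon> s) (at \<epsilon> within U)"
    and dw: "((\<lambda>\<epsilon>. u \<epsilon> s) has_vector_derivative w \<epsilon> s) (at \<epsilon> within U)"
    if "\<epsilon> \<in> U" "s \<in> {a..b}" for \<epsilon> s
    using has_vector_derivative_slice[OF G ep] has_vector_derivative_slice[OF H ep] that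
    by (auto simp: u_def g_def w_def image_subset_iff)
  have u_hor: "snd (u \<epsilon> s) = (1/2) *\<^sub>R quat_form (fst (u \<epsilon> s)) (fst (\<Gamma> \<epsilon> s))"
    and vel: "velocity a b (\<Gamma> \<epsilon>) s = u \<epsilon> s" if "\<epsilon> \<in> U" "s \<in> {a..b}" for \<epsilon> s
  proof -
    show "velocity a b (\<Gamma> \<epsilon>) s = u \<epsilon> s"
      by (rule vector_derivative_within_closed_interval[OF ab that(2) ds[OF that]])
    then show "snd (u \<epsilon> s) = (1/2) *\<^sub>R quat_form (fst (u \<epsilon> s)) (fst (\<Gamma> \<epsilon> s))"
      using hor[OF that(1)] that(2) unfolding horizontal_curve_def horizontal_space_iff by force
  qed
  have u0: "fst (u 0 s) = x1 s" if s: "s \<in> {a..b}" for s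
  proof -
    have "((\<lambda>s. fst (\<Gamma> 0 s)) has_vector_derivative fst (u 0 s)) (at s within {a..b})"
      by (intro has_vector_derivative_fst ds U s)
    then have "(x has_vector_derivative fst (u 0 s)) (at s within {a..b})"
      by (rule has_vector_derivative_transform[rotated 2]) (use s \<Gamma>0 in auto)
    then show ?thesis
      using vector_derivative_unique_within_closed_interval[of a b s x] dx[OF s] ab s by auto
  qed
  have len: "curve_length a b (\<Gamma> \<epsilon>) = integral {a..b} (\<lambda>s. norm (fst (u \<epsilon> s)))" if "\<epsilon> \<in> U" for \<epsilon>
    unfolding curve_length_def
  proof (rule Henstock_Kurzweil_Integration.integral_cong)
    fix s assume s: "s \<in> {a..b}"
    then have "z_coeff (\<Gamma> \<epsilon> s) (u \<epsilon> s) = 0" using u_hor[OF that] by (simp add: z_coeff_eq_0_iff)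
    then show "speed a b (\<Gamma> \<epsilon>) s = norm (fst (u \<epsilon> s))"
      by (simp add: speed_def vel[OF that s] h1_metric_def norm_eq_sqrt_inner)
  qed
  define y where "y s = fst (g 0 s)" for s
  have dy0: "((\<lambda>\<epsilon>. fst (\<Gamma> \<epsilon> s)) has_vector_derivative y s) (at 0)" if "s \<in> {a..b}" for s
    using has_vector_derivative_fst[OF dg[OF U(3) that]] at_within_open[OF U(3,1)] by (simp add: y_def)
  have fst_cont: "continuous_on (U \<times> {a..b}) (\<lambda>(\<epsilon>, s). fst (f \<epsilon> s))"
    if "continuous_on (U \<times> {a..b}) (\<lambda>(\<epsilon>, s). f \<epsilon> s)" for f :: "real \<Rightarrow> real \<Rightarrow> h1"
    using continuous_on_fst[OF that] by (simp add: case_prod_unfold)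
  have y_int: "y s = integral {a..s} (\<lambda>s. fst (w 0 s))" if s: "s \<in> {a..b}" for s
  proof -
    have "((\<lambda>\<epsilon>. integral (cbox a s) (\<lambda>\<sigma>. fst (u \<epsilon> \<sigma>))) has_vector_derivative
       integral (cbox a s) (\<lambda>\<sigma>. fst (w 0 \<sigma>))) (at 0 within U)"
    proof (rule leibniz_rule_vector_derivative[OF _ _ _ U(3) cU])
      fix \<epsilon> \<sigma> assume "\<epsilon> \<in> U" "\<sigma> \<in> cbox a s"
      then show "((\<lambda>\<epsilon>. fst (u \<epsilon> \<sigma>)) has_vector_derivative fst (w \<epsilon> \<sigma>)) (at \<epsilon> within U)"
        using s by (intro has_vector_derivative_fst dw) auto
    next
      fix \<epsilon> assume "\<epsilon> \<in> U"
      then show "(\<lambda>\<sigma>. fst (u \<epsilon> \<sigma>)) integrable_on cbox a s"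
        using s by (auto intro!: integrable_continuous_real continuous_on_fst
           continuous_on_subset[OF continuous_on_slice[OF cont(2)]])
    next
      show "continuous_on (U \<times> cbox a s) (\<lambda>(\<epsilon>, \<sigma>). fst (w \<epsilon> \<sigma>))"
        by (rule continuous_on_subset[OF fst_cont[OF cont(4)]]) (use s in auto)
    qed
    then have "((\<lambda>\<epsilon>. x a + integral {a..s} (\<lambda>\<sigma>. fst (u \<epsilon> \<sigma>))) has_vector_derivative
       0 + integral {a..s} (\<lambda>\<sigma>. fst (w 0 \<sigma>))) (at 0 within U)"
      by (intro has_vector_derivative_add has_vector_derivative_const) simp
    moreover have "fst (\<Gamma> \<epsilon> s) = x a + integral {a..s} (\<lambda>\<sigma>. fst (u \<epsilon> \<sigma>))" if "\<epsilon> \<in> U" for \<epsilon>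
    proof -
      have "((\<lambda>\<sigma>. fst (u \<epsilon> \<sigma>)) has_integral fst (\<Gamma> \<epsilon> s) - fst (\<Gamma> \<epsilon> a)) {a..s}"
        using s that by (intro fundamental_theorem_of_calculus has_vector_derivative_fst
            has_vector_derivative_within_subset[OF ds[OF that]]) auto
      then show ?thesis using ends(1)[OF that] by (simp add: integral_unique)
    qed
    ultimately have "((\<lambda>\<epsilon>. fst (\<Gamma> \<epsilon> s)) has_vector_derivative
        0 + integral {a..s} (\<lambda>\<sigma>. fst (w 0 \<sigma>))) (at 0 within U)"
      by (rule has_vector_derivative_transform[OF U(3), rotated])
    then show ?thesis
      using vector_derivative_unique_at[OF dy0[OF s]] at_within_open[OF U(3,1)] by simp
  qed
  have w0: "continuous_on {a..b} (\<lambda>s. fst (w 0 s))"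
    by (intro continuous_on_fst continuous_on_slice[OF cont(4)] U)
  have dy: "(y has_vector_derivative fst (w 0 s)) (at s within {a..b})" if "s \<in> {a..b}" for s
    by (rule has_vector_derivative_transform[OF that _ integral_has_vector_derivative[OF w0 that]])
      (simp add: y_int)
  have y_cont: "continuous_on {a..b} y" by (rule continuous_on_vector_derivative) (rule dy)
  have ya: "y a = 0" using y_int[of a] ab by simp
  have yb: "y b = 0"
  proof -
    have "((\<lambda>\<epsilon>. fst (\<Gamma> \<epsilon> b)) has_vector_derivative 0) (at 0 within U)"
      by (rule has_vector_derivative_transform[OF U(3) _ has_vector_derivative_const]) (simp add: ends(2))
    then show ?thesis
      using vector_derivative_unique_at[OF dy0[of b]] at_within_open[OF U(3,1)] ab by simp
  qed
  have constraint: "integral {a..b} (\<lambda>s. quat_form (y s) (x1 s)) = 0"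
  proof -
    \<comment> \<open>By horizontality \<open>?F\<close> is twice the central velocity, so its
      integral is \<open>2 *\<^sub>R (z b - z a)\<close> for every \<epsilon> in \<open>U\<close>
      and has derivative zero.\<close>
    let ?F = "\<lambda>\<epsilon> s. quat_form (fst (u \<epsilon> s)) (fst (\<Gamma> \<epsilon> s))"
    let ?F' = "\<lambda>\<epsilon> s. quat_form (fst (u \<epsilon> s)) (fst (g \<epsilon> s)) + quat_form (fst (w \<epsilon> s)) (fst (\<Gamma> \<epsilon> s))"
    have "((\<lambda>\<epsilon>. integral (cbox a b) (?F \<epsilon>)) has_vector_derivative integral (cbox a b) (?F' 0)) (at 0 within U)"
    proof (rule leibniz_rule_vector_derivative[OF _ _ _ U(3) cU])
      fix \<epsilon> s assume "\<epsilon> \<in> U" "s \<in> cbox a b"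
      then show "((\<lambda>\<epsilon>. ?F \<epsilon> s) has_vector_derivative ?F' \<epsilon> s) (at \<epsilon> within U)"
        by (intro quat_form.has_vector_derivative has_vector_derivative_fst dw dg) auto
    next
      fix \<epsilon> assume "\<epsilon> \<in> U"
      then show "?F \<epsilon> integrable_on cbox a b"
        unfolding box_real
        by (intro integrable_continuous_real quat_form.continuous_on continuous_on_fst cont[THEN continuous_on_slice])
    next
      show "continuous_on (U \<times> cbox a b) (\<lambda>(\<epsilon>, s). ?F' \<epsilon> s)"
        using cont[THEN fst_cont] unfolding case_prod_unfold box_real
        by (intro continuous_on_add quat_form.continuous_on)
    qed
    moreover have "2 *\<^sub>R (z b - z a) = integral (cbox a b) (?F \<epsilon>)" if "\<epsilon> \<in> U" for \<epsilon>
    proof -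
      have "((\<lambda>s. snd (u \<epsilon> s)) has_integral snd (\<Gamma> \<epsilon> b) - snd (\<Gamma> \<epsilon> a)) {a..b}"
        using ab that by (intro fundamental_theorem_of_calculus has_vector_derivative_snd ds) auto
      then have "((\<lambda>s. 2 *\<^sub>R snd (u \<epsilon> s)) has_integral 2 *\<^sub>R (snd (\<Gamma> \<epsilon> b) - snd (\<Gamma> \<epsilon> a))) {a..b}"
        by (rule has_integral_cmul)
      then have "(?F \<epsilon> has_integral 2 *\<^sub>R (snd (\<Gamma> \<epsilon> b) - snd (\<Gamma> \<epsilon> a))) {a..b}"
        by (rule has_integral_eq[rotated]) (simp add: u_hor that)
      then show ?thesis using ends that by (simp add: integral_unique)
    qed
    ultimately have "((\<lambda>\<epsilon>. 2 *\<^sub>R (z b - z a)) has_vector_derivative integral (cbox a b) (?F' 0)) (at 0 within U)"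
      by (rule has_vector_derivative_transform[OF U(3), rotated])
    then have "integral {a..b} (?F' 0) = 0"
      using vector_derivative_unique_at[OF has_vector_derivative_const] at_within_open[OF U(3,1)] by simp
    moreover have "integral {a..b} (?F' 0)
      = integral {a..b} (\<lambda>s. quat_form (fst (w 0 s)) (x s) - quat_form (y s) (x1 s))"
      by (intro Henstock_Kurzweil_Integration.integral_cong)
        (simp add: u0 \<Gamma>0 y_def[symmetric] quat_form_skew[of "y _"])
    moreover have "\<dots> = integral {a..b} (\<lambda>s. quat_form (fst (w 0 s)) (x s))
        - integral {a..b} (\<lambda>s. quat_form (y s) (x1 s))"
      by (intro integral_diff integrable_continuous_real quat_form.continuous_on w0 x_cont x1_cont y_cont)
    \<comment> \<open>Integration by parts turns the term with \<open>w\<close> into a second copy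
      of the other one, so the vanishing derivative is -2 times the integral in question.\<close>
    moreover have "integral {a..b} (\<lambda>s. quat_form (fst (w 0 s)) (x s))
        = - integral {a..b} (\<lambda>s. quat_form (y s) (x1 s))"
      using ab by (intro integral_by_parts_vanishing[OF bounded_bilinear_quat_form] ya yb dy dx w0 x1_cont) auto
    ultimately have "(2::real) *\<^sub>R integral {a..b} (\<lambda>s. quat_form (y s) (x1 s)) = 0"
      by (simp add: scaleR_2)
    then show ?thesis by simp
  qed
  have "((\<lambda>\<epsilon>. integral {a..b} (\<lambda>s. norm (fst (u \<epsilon> s)))) has_real_derivative
    integral {a..b} (\<lambda>s. fst (u 0 s) \<bullet> fst (w 0 s))) (at 0)"
  proof (rule norm_integral_has_derivative[OF U(1,3) fst_cont[OF cont(2)] fst_cont[OF cont(4)]])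
    show "((\<lambda>\<epsilon>. fst (u \<epsilon> s)) has_vector_derivative fst (w \<epsilon> s)) (at \<epsilon>)" if "\<epsilon> \<in> U" "s \<in> {a..b}" for \<epsilon> s
      using has_vector_derivative_fst[OF dw[OF that]] at_within_open[OF that(1) U(1)] by simp
  qed (simp add: u0 unit)
  moreover have "integral {a..b} (\<lambda>s. fst (u 0 s) \<bullet> fst (w 0 s)) = integral {a..b} (\<lambda>s. fst (w 0 s) \<bullet> x1 s)"
    by (intro Henstock_Kurzweil_Integration.integral_cong) (simp add: u0 inner_commute)
  moreover have "\<dots> = - integral {a..b} (\<lambda>s. y s \<bullet> x2 s)"
    using ab by (intro integral_by_parts_vanishing[OF bounded_bilinear_inner] ya yb dy dx1 w0 x2_cont) auto
  ultimately have "((\<lambda>\<epsilon>. integral {a..b} (\<lambda>s. norm (fst (u \<epsilon> s)))) has_real_derivative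
      - integral {a..b} (\<lambda>s. y s \<bullet> x2 s)) (at 0)" by simp
  then have "((\<lambda>\<epsilon>. curve_length a b (\<Gamma> \<epsilon>)) has_real_derivative - integral {a..b} (\<lambda>s. y s \<bullet> x2 s)) (at 0)"
    unfolding has_field_derivative_def
    by (rule has_derivative_transform_within_open[OF _ U(1,3)]) (simp add: len)
  then show thesis using that dy0 y_cont constraint by blast
qed

text \<open>The equation makes \<open>y s \<bullet> x2 s\<close> the inner product of
  \<open>quat_form (y s) (x1 s)\<close> with the constant vector of the \<open>\<mu> r\<close>. The
  integral constraint in \<open>first_variation\<close> therefore annihilates the rate of
  change.\<close>

lemma length_critical_if:
  assumes ode: "\<And>t. t \<in> {a..b} \<Longrightarrow> x2 t = (\<Sum>r\<in>UNIV. \<mu> r *\<^sub>R (quat r *v x1 t))"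
  shows "length_critical a b curve"
  unfolding length_critical_def
proof (intro allI impI)
  fix U \<Gamma> assume "admissible_variation a b curve U \<Gamma>"
  then obtain y where y: "continuous_on {a..b} y" "integral {a..b} (\<lambda>s. quat_form (y s) (x1 s)) = 0"
    and L: "((\<lambda>\<epsilon>. curve_length a b (\<Gamma> \<epsilon>)) has_real_derivative
      - integral {a..b} (\<lambda>s. y s \<bullet> x2 s)) (at 0)"
    by (rule first_variation)
  have "integral {a..b} (\<lambda>s. y s \<bullet> x2 s) = integral {a..b} (\<lambda>s. quat_form (y s) (x1 s) \<bullet> (\<chi> r. \<mu> r))"
    by (intro Henstock_Kurzweil_Integration.integral_cong)
      (simp add: ode quat_form_def inner_vec_def[of "vec_lambda _"] inner_sum_right mult.commute)
  also have "\<dots> = integral {a..b} (\<lambda>s. quat_form (y s) (x1 s)) \<bullet> (\<chi> r. \<mu> r)"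
    by (intro integral_component_eq integrable_continuous_real quat_form.continuous_on y x1_cont)
  finally show "((\<lambda>\<epsilon>. curve_length a b (\<Gamma> \<epsilon>)) has_real_derivative 0) (at 0)"
    using L y(2) by simp
qed

end


section \<open>Admissible perturbations\<close>

lemma Ck_on_imp_continuous_on: "Ck_on k S f \<Longrightarrow> continuous_on S f"
  by (induction k) (auto dest: Ck_on_Suc_D simp del: Ck_on.simps(2))

lemma Ck_on_integral:
  fixes f :: "real \<Rightarrow> 'b::banach"
  assumes "Ck_on k {a..b} f"
  shows "Ck_on (Suc k) {a..b} (\<lambda>t. integral {a..t} f)"
  unfolding Ck_on_Suc_real
  using integral_has_vector_derivative[OF Ck_on_imp_continuous_on[OF assms]] assms by blast

lemma Ck_on_real_polynomial_function:
  fixes p :: "real \<Rightarrow> real"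
  shows "real_polynomial_function p \<Longrightarrow> Ck_on k S p"
proof (induction k arbitrary: p)
  case 0
  then show ?case
    by (auto intro: continuous_at_imp_continuous_on continuous_real_polymonial_function)
next
  case (Suc k)
  obtain p' where p': "real_polynomial_function p'" "\<And>t. (p has_real_derivative p' t) (at t)"
    using has_real_derivative_polynomial_function[OF Suc.prems] by blast
  then have "(p has_vector_derivative p' t) (at t within S)" for t
    using has_real_derivative_iff_has_vector_derivative has_vector_derivative_at_within by blast
  then show ?case unfolding Ck_on_Suc_real using Suc.IH[OF p'(1)] by blast
qed

lemma Ck_on_fst: "Ck_on k S f \<Longrightarrow> Ck_on k (S \<times> T) (\<lambda>p. f (fst p))"
  by (rule Ck_on_compose_linear[OF bounded_linear_fst]) auto

lemma Ck_on_snd: "Ck_on k T f \<Longrightarrow> Ck_on k (S \<times> T) (\<lambda>p. f (snd p))"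
  by (rule Ck_on_compose_linear[OF bounded_linear_snd]) auto

lemmas Ck_on_quat_form = Ck_on_bilinear[OF bounded_bilinear_quat_form]

context unit_horizontal_curve
begin

lemma Ck_x1: "Ck_on 1 {a..b} x1"
  unfolding One_nat_def Ck_on_Suc_real using dx1 x2_cont by (intro exI[of _ x2]) simp

lemma Ck_x: "Ck_on 2 {a..b} x"
  by (rule Ck_on_2_realI[OF dx dx1 x2_cont])

text \<open>The derivative of \<open>z\<close> is bilinear in \<open>x1\<close> and
  \<open>x\<close>, which are both of class C^1.\<close>

lemma Ck_z: "Ck_on 2 {a..b} z"
proof -
  have "Ck_on (Suc 0) {a..b} x" "Ck_on (Suc 0) {a..b} x1"
    using Ck_x Ck_x1 by (auto simp: numeral_2_eq_2 dest: Ck_on_Suc_D simp del: Ck_on.simps(2))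
  then have "Ck_on (Suc 0) {a..b} (\<lambda>t. (1/2) *\<^sub>R quat_form (x1 t) (x t))"
    by (intro Ck_on_scaleR Ck_on_const Ck_on_quat_form)
  with dz show ?thesis
    unfolding numeral_2_eq_2 Ck_on_Suc_real[of "Suc 0"]
    by (intro exI[of _ "\<lambda>t. (1/2) *\<^sub>R quat_form (x1 t) (x t)"]) simp
qed

text \<open>The curve is moved in the fixed direction \<open>d\<close> with profile \<open>\<psi>\<close>, and the end point of the
  central component is restored by a correction \<open>c \<epsilon>\<close> with profile \<open>\<phi>\<close>. Since \<open>quat_form\<close> is skew and
  \<open>\<phi>\<close> is scalar, the terms quadratic in \<open>c \<epsilon>\<close> vanish, so the end point condition is the linear system
  \<open>quat_form (c \<epsilon>) (v + \<epsilon> \<kappa> d) = - \<epsilon> quat_form d w\<close>, which the orthogonality of the quaternion units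
  solves explicitly.\<close>

lemma length_critical_orthogonal:
  assumes crit: "length_critical a b curve"
    and \<phi>: "real_polynomial_function \<phi>" "\<phi> a = 0" "\<phi> b = 0"
    and \<psi>: "real_polynomial_function \<psi>" "\<psi> a = 0" "\<psi> b = 0"
  defines "v \<equiv> integral {a..b} (\<lambda>t. \<phi> t *\<^sub>R x1 t)"
    and "w \<equiv> integral {a..b} (\<lambda>t. \<psi> t *\<^sub>R x1 t)"
    and "p \<equiv> integral {a..b} (\<lambda>t. \<phi> t *\<^sub>R x2 t)"
  assumes "v \<noteq> 0"
  shows "d \<bullet> integral {a..b} (\<lambda>t. \<psi> t *\<^sub>R x2 t) =
    d \<bullet> (\<Sum>k\<in>UNIV. (((quat k *v v) \<bullet> p) / (v \<bullet> v)) *\<^sub>R (quat k *v w))"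
proof -
  obtain \<phi>' where \<phi>': "real_polynomial_function \<phi>'" "\<And>t. (\<phi> has_real_derivative \<phi>' t) (at t)"
    using has_real_derivative_polynomial_function[OF \<phi>(1)] by blast
  obtain \<psi>' where \<psi>': "real_polynomial_function \<psi>'" "\<And>t. (\<psi> has_real_derivative \<psi>' t) (at t)"
    using has_real_derivative_polynomial_function[OF \<psi>(1)] by blast
  note poly = Ck_on_real_polynomial_function[OF \<phi>(1)] Ck_on_real_polynomial_function[OF \<psi>(1)]
    Ck_on_real_polynomial_function[OF \<phi>'(1)] Ck_on_real_polynomial_function[OF \<psi>'(1)]
  note pcont = poly[THEN Ck_on_imp_continuous_on]
  have d\<phi>: "(\<phi> has_real_derivative \<phi>' t) (at t within S)"
    and d\<psi>: "(\<psi> has_real_derivative \<psi>' t) (at t within S)" for t S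
    using \<phi>'(2) \<psi>'(2) by (auto intro: has_field_derivative_at_within)
  \<comment> \<open>These primitives let the perturbed central component be written in closed form:
    \<open>V\<close> and \<open>W\<close> enter the terms linear in the perturbation, and
    \<open>K\<close> collects the interaction of the two profiles.\<close>
  define V where "V s = integral {a..s} (\<lambda>t. \<phi> t *\<^sub>R x1 t)" for s
  define W where "W s = integral {a..s} (\<lambda>t. \<psi> t *\<^sub>R x1 t)" for s
  define K where "K s = integral {a..s} (\<lambda>t. \<psi>' t * \<phi> t - \<phi>' t * \<psi> t)" for s
  have Ck_V: "Ck_on 2 {a..b} V" and Ck_W: "Ck_on 2 {a..b} W"
    unfolding V_def[abs_def] W_def[abs_def] numeral_2_eq_2
    using Ck_x1 by (auto intro!: Ck_on_integral Ck_on_scaleR poly simp del: Ck_on.simps)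
  have Ck_K: "Ck_on 2 {a..b} K"
    unfolding K_def[abs_def] numeral_2_eq_2
    by (intro Ck_on_integral Ck_on_diff Ck_on_bilinear[OF bounded_bilinear_mult] poly)
  have dV: "(V has_vector_derivative \<phi> s *\<^sub>R x1 s) (at s within {a..b})"
    and dW: "(W has_vector_derivative \<psi> s *\<^sub>R x1 s) (at s within {a..b})"
    and dK: "(K has_vector_derivative \<psi>' s * \<phi> s - \<phi>' s * \<psi> s) (at s within {a..b})"
    if "s \<in> {a..b}" for s
    unfolding V_def[abs_def] W_def[abs_def] K_def[abs_def]
    using that by (auto intro!: integral_has_vector_derivative continuous_intros pcont x1_cont)
  have at_a: "V a = 0" "W a = 0" "K a = 0" by (simp_all add: V_def W_def K_def)
  have at_b: "V b = v" "W b = w" by (simp_all add: V_def W_def v_def w_def)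
  define \<beta> where "\<beta> = quat_form d w"
  define \<kappa> where "\<kappa> = K b / 2"
  \<comment> \<open>Shifting \<open>v\<close> by a multiple of \<open>d\<close> absorbs the
    interaction term \<open>quat_form d (c \<epsilon>)\<close>, so the closing condition becomes
    linear in \<open>c \<epsilon>\<close>. Near \<epsilon> = 0 the vector
    \<open>q \<epsilon>\<close> stays nonzero because \<open>v\<close> is.\<close>
  define q where "q \<epsilon> = v + (\<epsilon> * \<kappa>) *\<^sub>R d" for \<epsilon>
  have "isCont q 0" unfolding q_def by (intro continuous_intros)
  moreover have "q 0 \<noteq> 0" using \<open>v \<noteq> 0\<close> by (simp add: q_def)
  ultimately obtain e where e: "e > 0" "\<And>\<epsilon>. dist 0 \<epsilon> < e \<Longrightarrow> q \<epsilon> \<noteq> 0"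
    using continuous_at_avoid[of 0 q 0] by blast
  define U where "U = ball (0::real) e"
  have U: "open U" "is_interval U" "0 \<in> U" using e(1) by (auto simp: U_def is_interval_ball_real)
  have q0: "q \<epsilon> \<bullet> q \<epsilon> \<noteq> 0" if "\<epsilon> \<in> U" for \<epsilon> using e(2) that by (simp add: U_def)
  \<comment> \<open>The preimage of \<open>- \<beta>\<close> under
    \<open>quat_form _ (q \<epsilon>)\<close> supplied by
    \<open>quat_form_quat_mult\<close>.\<close>
  define E where "E \<epsilon> = - inverse (q \<epsilon> \<bullet> q \<epsilon>) *\<^sub>R (\<Sum>k\<in>UNIV. \<beta> $ k *\<^sub>R (quat k *v q \<epsilon>))" for \<epsilon>
  define c where "c \<epsilon> = \<epsilon> *\<^sub>R E \<epsilon>" for \<epsilon>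
  have Ck_q: "Ck_on k U q" for k
    unfolding q_def[abs_def]
    by (intro Ck_on_add Ck_on_const Ck_on_scaleR Ck_on_bilinear[OF bounded_bilinear_mult] Ck_on_ident)
  have Ck_E: "Ck_on k U E" for k
    unfolding E_def[abs_def]
    by (intro Ck_on_scaleR Ck_on_uminus Ck_on_inverse Ck_on_bilinear[OF bounded_bilinear_inner] Ck_on_sum
        Ck_on_const Ck_on_linear[OF matrix_vector_mul_bounded_linear] Ck_q q0 finite)
  have Ck_c: "Ck_on k U c" for k
    unfolding c_def[abs_def] by (intro Ck_on_scaleR Ck_on_ident Ck_E)
  have "quat_form (E \<epsilon>) (q \<epsilon>) = - \<beta>" if "\<epsilon> \<in> U" for \<epsilon>
    using q0[OF that] by (simp add: E_def quat_form.minus_left quat_form.scaleR_left quat_form_quat_mult)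
  then have closing: "\<epsilon> *\<^sub>R \<beta> + quat_form (c \<epsilon>) v = (\<epsilon> * \<kappa>) *\<^sub>R quat_form d (c \<epsilon>)" if "\<epsilon> \<in> U" for \<epsilon>
  proof -
    have "quat_form (c \<epsilon>) (q \<epsilon>) = - (\<epsilon> *\<^sub>R \<beta>)"
      using \<open>\<And>\<epsilon>. \<epsilon> \<in> U \<Longrightarrow> quat_form (E \<epsilon>) (q \<epsilon>) = - \<beta>\<close>[OF that]
      by (simp add: c_def quat_form.scaleR_left)
    moreover have "quat_form (c \<epsilon>) (q \<epsilon>) = quat_form (c \<epsilon>) v - (\<epsilon> * \<kappa>) *\<^sub>R quat_form d (c \<epsilon>)"
      by (simp add: q_def quat_form.add_right quat_form.scaleR_right quat_form_skew[of "c \<epsilon>" d])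
    ultimately show ?thesis by (simp add: algebra_simps)
  qed
  define y where "y \<epsilon> s = (\<epsilon> * \<psi> s) *\<^sub>R d + \<phi> s *\<^sub>R c \<epsilon>" for \<epsilon> s
  \<comment> \<open>Twice the change of the central component. With \<open>y'\<close> the derivative
    of \<open>y \<epsilon>\<close> in \<open>s\<close>, the increment of
    \<open>quat_form x' x\<close> is
    \<open>quat_form y' x + quat_form x' y + quat_form y' y\<close>. The first two terms are the
    derivative of \<open>quat_form y x\<close> minus \<open>2 *\<^sub>R quat_form y x'\<close>,
    which gives the terms with \<open>W\<close> and \<open>V\<close>; by skewness the last is a
    multiple of \<open>quat_form d (c \<epsilon>)\<close>, with primitive given by
    \<open>K\<close>.\<close>
  define h where "h \<epsilon> s = quat_form (y \<epsilon> s) (x s)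
      - 2 *\<^sub>R (\<epsilon> *\<^sub>R quat_form d (W s) + quat_form (c \<epsilon>) (V s)) + (\<epsilon> * K s) *\<^sub>R quat_form d (c \<epsilon>)" for \<epsilon> s
  define \<Gamma> where "\<Gamma> \<epsilon> s = (x s + y \<epsilon> s, z s + (1/2) *\<^sub>R h \<epsilon> s)" for \<epsilon> s
  have "Ck_on 2 ({a..b} \<times> U) (\<lambda>p. \<Gamma> (snd p) (fst p))"
    unfolding \<Gamma>_def y_def h_def
    by (intro Ck_on_Pair Ck_on_add Ck_on_diff Ck_on_scaleR Ck_on_quat_form Ck_on_const
        Ck_on_bilinear[OF bounded_bilinear_mult]
        Ck_on_snd[OF Ck_c] Ck_on_snd[OF Ck_on_ident] Ck_on_fst[OF poly(1)] Ck_on_fst[OF poly(2)]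
        Ck_on_fst[OF Ck_x] Ck_on_fst[OF Ck_z] Ck_on_fst[OF Ck_V] Ck_on_fst[OF Ck_W] Ck_on_fst[OF Ck_K])
  moreover have "\<Gamma> 0 s = (x s, z s)" for s
    by (simp add: \<Gamma>_def y_def h_def c_def quat_form.zero_left)
  moreover have "\<Gamma> \<epsilon> a = (x a, z a)" for \<epsilon>
    by (simp add: \<Gamma>_def y_def h_def \<phi> \<psi> at_a quat_form.zero_left quat_form.zero_right)
  moreover have "\<Gamma> \<epsilon> b = (x b, z b)" if "\<epsilon> \<in> U" for \<epsilon>
  proof -
    have "h \<epsilon> b = - 2 *\<^sub>R (\<epsilon> *\<^sub>R \<beta> + quat_form (c \<epsilon>) v) + 2 *\<^sub>R ((\<epsilon> * \<kappa>) *\<^sub>R quat_form d (c \<epsilon>))"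
      by (simp add: h_def y_def \<phi> \<psi> at_b quat_form.zero_left \<beta>_def \<kappa>_def)
    also have "\<dots> = 0" unfolding closing[OF that] by simp
    finally show ?thesis by (simp add: \<Gamma>_def y_def \<phi> \<psi>)
  qed
  moreover have "horizontal_curve a b (\<Gamma> \<epsilon>)" for \<epsilon>
    unfolding horizontal_curve_def horizontal_space_iff
  proof
    fix s assume s: "s \<in> {a..b}"
    let ?y' = "(\<epsilon> * \<psi>' s) *\<^sub>R d + \<phi>' s *\<^sub>R c \<epsilon>"
    let ?h' = "(quat_form (y \<epsilon> s) (x1 s) + quat_form ?y' (x s))
      - 2 *\<^sub>R (\<epsilon> *\<^sub>R quat_form d (\<psi> s *\<^sub>R x1 s) + quat_form (c \<epsilon>) (\<phi> s *\<^sub>R x1 s))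
      + (\<epsilon> * (\<psi>' s * \<phi> s - \<phi>' s * \<psi> s)) *\<^sub>R quat_form d (c \<epsilon>)"
    have dy: "(y \<epsilon> has_vector_derivative ?y') (at s within {a..b})"
    proof -
      have "((\<lambda>s. (\<epsilon> * \<psi> s) *\<^sub>R d) has_vector_derivative (\<epsilon> * \<psi>' s) *\<^sub>R d) (at s within {a..b})"
        "((\<lambda>s. \<phi> s *\<^sub>R c \<epsilon>) has_vector_derivative \<phi>' s *\<^sub>R c \<epsilon>) (at s within {a..b})"
        using has_vector_derivative_scaleR[OF DERIV_cmult[OF d\<psi>, of \<epsilon>] has_vector_derivative_const[of d]]
          has_vector_derivative_scaleR[OF d\<phi> has_vector_derivative_const[of "c \<epsilon>"]] by simp_all
      then show ?thesis unfolding y_def[abs_def] by (rule has_vector_derivative_add)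
    qed
    have lin: "((\<lambda>s. quat_form u (f s)) has_vector_derivative quat_form u f') (at s within {a..b})"
      if "(f has_vector_derivative f') (at s within {a..b})" for u f f'
      by (rule bounded_linear.has_vector_derivative[OF quat_form.bounded_linear_right that])
    have sc: "((\<lambda>s. r *\<^sub>R f s) has_vector_derivative r *\<^sub>R f') (at s within {a..b})"
      if "(f has_vector_derivative f') (at s within {a..b})" for r and f :: "real \<Rightarrow> real^3" and f'
      by (rule bounded_linear.has_vector_derivative[OF bounded_linear_scaleR_right that])
    have scl: "((\<lambda>s. (r * f s) *\<^sub>R u) has_vector_derivative (r * f') *\<^sub>R u) (at s within {a..b})"
      if "(f has_vector_derivative f') (at s within {a..b})" for r f f' and u :: "real^3"
      by (rule bounded_linear.has_vector_derivative[OF _ that])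
        (intro bounded_linear_scaleR_const bounded_linear_mult_right)
    have "(h \<epsilon> has_vector_derivative ?h') (at s within {a..b})"
      unfolding h_def[abs_def]
      by (intro has_vector_derivative_add has_vector_derivative_diff quat_form.has_vector_derivative
          lin sc scl dy dx dV dW dK s)
    then have "(\<Gamma> \<epsilon> has_vector_derivative (x1 s + ?y', (1/2) *\<^sub>R quat_form (x1 s) (x s) + (1/2) *\<^sub>R ?h'))
        (at s within {a..b})"
      unfolding \<Gamma>_def[abs_def]
      by (intro has_vector_derivative_Pair has_vector_derivative_add sc dy dx dz s)
    then have vel: "velocity a b (\<Gamma> \<epsilon>) s = (x1 s + ?y', (1/2) *\<^sub>R quat_form (x1 s) (x s) + (1/2) *\<^sub>R ?h')"
      by (rule vector_derivative_within_closed_interval[OF ab s])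
    have "quat_form (x1 s) (x s) + ?h' = quat_form (x1 s + ?y') (x s + y \<epsilon> s)"
      unfolding y_def
      by (simp add: vec_eq_iff quat_form.add_left quat_form.add_right quat_form.scaleR_left
          quat_form.scaleR_right quat_form_skew[of "x1 s" d] quat_form_skew[of "x1 s" "c \<epsilon>"]
          quat_form_skew[of "c \<epsilon>" d] algebra_simps)
    then show "snd (velocity a b (\<Gamma> \<epsilon>) s)
        = (1/2) *\<^sub>R quat_form (fst (velocity a b (\<Gamma> \<epsilon>) s)) (fst (\<Gamma> \<epsilon> s))"
      unfolding vel by (simp add: \<Gamma>_def scaleR_add_right[symmetric])
  qed
  ultimately have adm: "admissible_variation a b curve U \<Gamma>"
    using U unfolding admissible_variation_def variation_def by (auto simp: case_prod_unfold)
  then obtain Y where Y: "\<And>s. s \<in> {a..b} \<Longrightarrow> ((\<lambda>\<epsilon>. fst (\<Gamma> \<epsilon> s)) has_vector_derivative Y s) (at 0)"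
    and "continuous_on {a..b} Y" and "integral {a..b} (\<lambda>s. quat_form (Y s) (x1 s)) = 0"
    and L: "((\<lambda>\<epsilon>. curve_length a b (\<Gamma> \<epsilon>)) has_real_derivative
      - integral {a..b} (\<lambda>s. Y s \<bullet> x2 s)) (at 0)"
    by (rule first_variation) (rule that; assumption)
  have "((\<lambda>\<epsilon>. curve_length a b (\<Gamma> \<epsilon>)) has_real_derivative 0) (at 0)"
    using crit adm unfolding length_critical_def by blast
  then have stat: "integral {a..b} (\<lambda>s. Y s \<bullet> x2 s) = 0" using DERIV_unique[OF L] by fastforce
  \<comment> \<open>Since \<open>c \<epsilon>\<close> is \<epsilon> times
    \<open>E \<epsilon>\<close>, its derivative at 0 is \<open>E 0\<close>.\<close>
  have dc: "(c has_vector_derivative E 0) (at 0)"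
  proof -
    obtain E' where "\<forall>\<epsilon>\<in>U. (E has_vector_derivative E' \<epsilon>) (at \<epsilon> within U)"
      using Ck_E[of "Suc 0"] unfolding Ck_on_Suc_real by blast
    then have "(E has_vector_derivative E' 0) (at 0)" using U(3) at_within_open[OF U(3,1)] by force
    from has_vector_derivative_scaleR[OF DERIV_ident this] show ?thesis by (simp add: c_def[abs_def])
  qed
  have Y_eq: "Y s = \<psi> s *\<^sub>R d + \<phi> s *\<^sub>R E 0" if "s \<in> {a..b}" for s
  proof -
    have "((\<lambda>\<epsilon>. (\<psi> s * \<epsilon>) *\<^sub>R d) has_vector_derivative (\<psi> s * 1) *\<^sub>R d) (at 0)"
      by (rule bounded_linear.has_vector_derivative[OF _ has_vector_derivative_id])
        (intro bounded_linear_scaleR_const bounded_linear_mult_right)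
    then have "((\<lambda>\<epsilon>. x s + ((\<psi> s * \<epsilon>) *\<^sub>R d + \<phi> s *\<^sub>R c \<epsilon>)) has_vector_derivative
        0 + ((\<psi> s * 1) *\<^sub>R d + \<phi> s *\<^sub>R E 0)) (at 0)"
      by (intro has_vector_derivative_add has_vector_derivative_const
          bounded_linear.has_vector_derivative[OF bounded_linear_scaleR_right dc])
    then have "((\<lambda>\<epsilon>. fst (\<Gamma> \<epsilon> s)) has_vector_derivative \<psi> s *\<^sub>R d + \<phi> s *\<^sub>R E 0) (at 0)"
      by (simp add: \<Gamma>_def y_def mult.commute)
    with Y[OF that] show ?thesis by (rule vector_derivative_unique_at)
  qed
  have int: "(\<lambda>t. \<phi> t *\<^sub>R x2 t) integrable_on {a..b}" "(\<lambda>t. \<psi> t *\<^sub>R x2 t) integrable_on {a..b}"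
    by (intro integrable_continuous_real continuous_intros pcont x2_cont)+
  have "integral {a..b} (\<lambda>s. Y s \<bullet> x2 s)
      = integral {a..b} (\<lambda>s. (\<psi> s *\<^sub>R x2 s) \<bullet> d + (\<phi> s *\<^sub>R x2 s) \<bullet> E 0)"
    by (intro Henstock_Kurzweil_Integration.integral_cong)
      (simp add: Y_eq inner_add_left inner_commute[of "x2 _"])
  also have "\<dots> = integral {a..b} (\<lambda>s. (\<psi> s *\<^sub>R x2 s) \<bullet> d) + integral {a..b} (\<lambda>s. (\<phi> s *\<^sub>R x2 s) \<bullet> E 0)"
    by (intro Henstock_Kurzweil_Integration.integral_add integrable_continuous_real continuous_intros
        pcont x2_cont)
  also have "\<dots> = integral {a..b} (\<lambda>t. \<psi> t *\<^sub>R x2 t) \<bullet> d + p \<bullet> E 0"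
    unfolding integral_component_eq[OF int(1)] integral_component_eq[OF int(2)] p_def ..
  finally have "d \<bullet> integral {a..b} (\<lambda>t. \<psi> t *\<^sub>R x2 t) = - (p \<bullet> E 0)"
    using stat by (simp add: inner_commute)
  \<comment> \<open>Here \<open>q 0 = v\<close>, and the component \<open>\<beta> $ k\<close> is
    \<open>d \<bullet> (quat k *v w)\<close>; moving \<open>d\<close> out leaves coefficients that
    involve only \<open>v\<close> and \<open>p\<close>.\<close>
  also have "\<dots> = d \<bullet> (\<Sum>k\<in>UNIV. (((quat k *v v) \<bullet> p) / (v \<bullet> v)) *\<^sub>R (quat k *v w))"
    by (simp add: E_def q_def \<beta>_def quat_form_def inner_sum_right sum_distrib_left inner_commute
        field_simps)
  finally show ?thesis .
qed

text \<open>The correction profile \<phi> is chosen once, so the multipliers from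
  \<open>length_critical_orthogonal\<close> stay fixed while \<psi> and \<open>d\<close> vary. The
  map \<open>M\<close> is linear and commutes with the integral, so the fundamental lemma applies to
  \<open>x2 t - M (x1 t)\<close>.\<close>

lemma length_critical_imp_ode:
  assumes crit: "length_critical a b curve"
  shows "\<exists>\<mu>. \<forall>t\<in>{a..b}. x2 t = (\<Sum>r\<in>UNIV. \<mu> r *\<^sub>R (quat r *v x1 t))"
proof -
  have "x1 a \<noteq> 0" using unit[of a] ab by auto
  \<comment> \<open>If every such integral vanished, the fundamental lemma would force
    \<open>x1 a = 0\<close>.\<close>
  then obtain \<phi> where \<phi>: "real_polynomial_function \<phi>" "\<phi> a = 0" "\<phi> b = 0"
    "integral {a..b} (\<lambda>t. \<phi> t *\<^sub>R x1 t) \<noteq> 0"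
    using fundamental_lemma_polynomial_vector[OF ab x1_cont, of a] ab by auto
  let ?v = "integral {a..b} (\<lambda>t. \<phi> t *\<^sub>R x1 t)" and ?p = "integral {a..b} (\<lambda>t. \<phi> t *\<^sub>R x2 t)"
  define \<mu> where "\<mu> k = ((quat k *v ?v) \<bullet> ?p) / (?v \<bullet> ?v)" for k
  define M where "M u = (\<Sum>k\<in>UNIV. \<mu> k *\<^sub>R (quat k *v u))" for u
  have M: "bounded_linear M"
    unfolding M_def[abs_def]
    by (intro bounded_linear_sum bounded_linear_compose[OF bounded_linear_scaleR_right]
        matrix_vector_mul_bounded_linear)
  have "x2 t - M (x1 t) = 0" if "t \<in> {a..b}" for t
  proof (rule fundamental_lemma_polynomial_vector[OF ab _ _ that])
    show "continuous_on {a..b} (\<lambda>t. x2 t - M (x1 t))"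
      by (intro continuous_on_diff x2_cont bounded_linear.continuous_on[OF M] x1_cont)
    fix \<psi> :: "real \<Rightarrow> real" assume \<psi>: "real_polynomial_function \<psi>" "\<psi> a = 0" "\<psi> b = 0"
    note \<psi>c = Ck_on_imp_continuous_on[OF Ck_on_real_polynomial_function[OF \<psi>(1)]]
    have int: "(\<lambda>t. \<psi> t *\<^sub>R x1 t) integrable_on {a..b}" "(\<lambda>t. \<psi> t *\<^sub>R x2 t) integrable_on {a..b}"
      by (intro integrable_continuous_real continuous_intros \<psi>c x1_cont x2_cont)+
    have "d \<bullet> integral {a..b} (\<lambda>t. \<psi> t *\<^sub>R x2 t) = d \<bullet> M (integral {a..b} (\<lambda>t. \<psi> t *\<^sub>R x1 t))" for d
      unfolding M_def \<mu>_def by (rule length_critical_orthogonal[OF crit \<phi>(1-3) \<psi> \<phi>(4)])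
    then have "integral {a..b} (\<lambda>t. \<psi> t *\<^sub>R x2 t) = M (integral {a..b} (\<lambda>t. \<psi> t *\<^sub>R x1 t))"
      using vector_eq_ldot by blast
    also have "\<dots> = integral {a..b} (\<lambda>t. M (\<psi> t *\<^sub>R x1 t))"
      using integral_linear[OF int(1) M] by (simp add: o_def)
    finally have "integral {a..b} (\<lambda>t. \<psi> t *\<^sub>R x2 t) - integral {a..b} (\<lambda>t. M (\<psi> t *\<^sub>R x1 t)) = 0" by simp
    moreover have "integral {a..b} (\<lambda>t. \<psi> t *\<^sub>R x2 t - M (\<psi> t *\<^sub>R x1 t))
        = integral {a..b} (\<lambda>t. \<psi> t *\<^sub>R x2 t) - integral {a..b} (\<lambda>t. M (\<psi> t *\<^sub>R x1 t))"
      using integrable_linear[OF int(1) M] by (intro integral_diff int) (simp add: o_def)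
    ultimately show "integral {a..b} (\<lambda>t. \<psi> t *\<^sub>R (x2 t - M (x1 t))) = 0"
      by (simp add: scaleR_diff_right linear_scale[OF bounded_linear.linear[OF M]])
  qed
  then show ?thesis by (auto simp: M_def)
qed

lemma length_critical_iff:
  "length_critical a b curve \<longleftrightarrow>
    (\<exists>\<mu>. \<forall>t\<in>{a..b}. x2 t = (\<Sum>r\<in>UNIV. \<mu> r *\<^sub>R (quat r *v x1 t)))"
  using length_critical_imp_ode length_critical_if by blast

end

section \<open>Reduction of the equation on the group to its first component\<close>

theorem theorem3:
  fixes nabla :: "(h1 \<Rightarrow> h1) \<Rightarrow> (h1 \<Rightarrow> h1) \<Rightarrow> (h1 \<Rightarrow> h1)"
    and \<gamma> :: "real \<Rightarrow> h1" and a b :: real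
  assumes "levi_civita h1_metric nabla"
    and "a < b"
    and "Ck_on 2 {a..b} \<gamma>"
    and "horizontal_curve a b \<gamma>"
    and "\<forall>t\<in>{a..b}. speed a b \<gamma> t = 1"
  shows "length_critical a b \<gamma> \<longleftrightarrow>
    (\<exists>lam :: 3 \<Rightarrow> real. \<forall>t\<in>{a..b}.
       cov_deriv nabla a b \<gamma> (velocity a b \<gamma>) t
         - 2 *\<^sub>R (\<Sum>r\<in>UNIV. lam r *\<^sub>R J_map nabla r (\<gamma> t) (velocity a b \<gamma> t)) = 0)"
proof -
  obtain v w where v: "\<And>t. t \<in> {a..b} \<Longrightarrow> (\<gamma> has_vector_derivative v t) (at t within {a..b})"
    and w: "\<And>t. t \<in> {a..b} \<Longrightarrow> (v has_vector_derivative w t) (at t within {a..b})"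
    and wc: "continuous_on {a..b} w"
    using Ck_on_2_realE[OF assms(3)] by blast
  have vel: "velocity a b \<gamma> t = v t" if "t \<in> {a..b}" for t
    by (rule vector_derivative_within_closed_interval[OF assms(2) that v[OF that]])
  have hor: "snd (v t) = (1/2) *\<^sub>R quat_form (fst (v t)) (fst (\<gamma> t))" if "t \<in> {a..b}" for t
    using assms(4) vel[OF that] that unfolding horizontal_curve_def horizontal_space_iff by force
  have z0: "z_coeff (\<gamma> t) (v t) = 0" if "t \<in> {a..b}" for t
    using hor[OF that] by (simp add: z_coeff_eq_0_iff)
  have acc: "velocity a b (velocity a b \<gamma>) t = w t" if "t \<in> {a..b}" for t
    by (rule vector_derivative_within_closed_interval[OF assms(2) that])
      (rule has_vector_derivative_transform[OF that vel w[OF that]])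
  have dsnd: "((\<lambda>t. snd (\<gamma> t)) has_vector_derivative (1/2) *\<^sub>R quat_form (fst (v t)) (fst (\<gamma> t)))
      (at t within {a..b})" if "t \<in> {a..b}" for t
    using has_vector_derivative_snd[OF v[OF that]] hor[OF that] by simp
  interpret unit_horizontal_curve a b "\<lambda>t. fst (\<gamma> t)" "\<lambda>t. fst (v t)" "\<lambda>t. fst (w t)" "\<lambda>t. snd (\<gamma> t)"
  proof
    show "norm (fst (v t)) = 1" if "t \<in> {a..b}" for t
      using bspec[OF assms(5) that] z0[OF that] vel[OF that]
      by (simp add: speed_def h1_metric_def norm_eq_sqrt_inner)
  qed (use assms(2) v w wc dsnd in \<open>auto intro: has_vector_derivative_fst continuous_on_fst\<close>)
  \<comment> \<open>Differentiating the horizontality relation produces a term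
    \<open>quat_form (fst (v t)) (fst (v t))\<close>, which vanishes by skewness; hence the
    acceleration is again horizontal.\<close>
  have w_hor: "snd (w t) = (1/2) *\<^sub>R quat_form (fst (w t)) (fst (\<gamma> t))" if t: "t \<in> {a..b}" for t
  proof -
    have "((\<lambda>t. (1/2) *\<^sub>R quat_form (fst (v t)) (fst (\<gamma> t))) has_vector_derivative
      (1/2) *\<^sub>R (quat_form (fst (v t)) (fst (v t)) + quat_form (fst (w t)) (fst (\<gamma> t)))) (at t within {a..b})"
      by (intro bounded_linear.has_vector_derivative[OF bounded_linear_scaleR_right]
          quat_form.has_vector_derivative has_vector_derivative_fst v w t)
    then have "((\<lambda>t. (1/2) *\<^sub>R quat_form (fst (v t)) (fst (\<gamma> t))) has_vector_derivative
      (1/2) *\<^sub>R quat_form (fst (w t)) (fst (\<gamma> t))) (at t within {a..b})" by simp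
    from has_vector_derivative_transform[OF t hor this] show ?thesis
      using vector_derivative_unique_within_closed_interval[of a b t "\<lambda>t. snd (v t)"]
        has_vector_derivative_snd[OF w[OF t]] assms(2) t by auto
  qed
  have eq: "cov_deriv nabla a b \<gamma> (velocity a b \<gamma>) t
         - 2 *\<^sub>R (\<Sum>r\<in>UNIV. lam r *\<^sub>R J_map nabla r (\<gamma> t) (velocity a b \<gamma> t)) = 0
      \<longleftrightarrow> fst (w t) = (\<Sum>r\<in>UNIV. (- 2 * lam r) *\<^sub>R (quat r *v fst (v t)))" (is "?D = 0 \<longleftrightarrow> _")
    if t: "t \<in> {a..b}" for lam t
  proof -
    have D: "?D = w t + 2 *\<^sub>R (\<Sum>r\<in>UNIV. lam r *\<^sub>R
        (quat r *v fst (v t), (1/2) *\<^sub>R quat_form (quat r *v fst (v t)) (fst (\<gamma> t))))"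
      by (simp add: cov_deriv_h1[OF assms(1)] vel[OF t] acc[OF t] christoffel_horizontal[OF z0[OF t]]
          J_map_h1[OF assms(1) z0[OF t]] prod_eq_iff fst_sum snd_sum sum_negf)
    have f: "fst ?D = fst (w t) - (\<Sum>r\<in>UNIV. (- 2 * lam r) *\<^sub>R (quat r *v fst (v t)))"
      unfolding D by (simp add: fst_sum scaleR_sum_right sum_negf)
    \<comment> \<open>The acceleration and the \<open>J_map\<close> terms are all horizontal, so the
      central component of the equation follows from its first component.\<close>
    have s: "snd ?D = (1/2) *\<^sub>R quat_form (fst ?D) (fst (\<gamma> t))"
      unfolding D
      by (simp add: snd_sum fst_sum w_hor[OF t] quat_form.add_left quat_form.scaleR_left quat_form.sum_left
          scaleR_sum_right scaleR_add_right)
    have "?D = 0 \<longleftrightarrow> fst ?D = 0" using s by (auto simp: prod_eq_iff quat_form.zero_left)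
    then show ?thesis unfolding f by simp
  qed
  have "length_critical a b \<gamma> \<longleftrightarrow>
      (\<exists>\<mu>. \<forall>t\<in>{a..b}. fst (w t) = (\<Sum>r\<in>UNIV. \<mu> r *\<^sub>R (quat r *v fst (v t))))"
    using length_critical_iff by simp
  also have "\<dots> \<longleftrightarrow> (\<exists>lam. \<forall>t\<in>{a..b}. fst (w t) = (\<Sum>r\<in>UNIV. (- 2 * lam r) *\<^sub>R (quat r *v fst (v t))))"
    (is "?P \<longleftrightarrow> ?Q")
  proof
    assume ?P
    then obtain \<mu> where "\<forall>t\<in>{a..b}. fst (w t) = (\<Sum>r\<in>UNIV. \<mu> r *\<^sub>R (quat r *v fst (v t)))" ..
    \<comment> \<open>The factor -1/2 undoes the 2 in the equation and the sign in
      \<open>J_map_h1\<close>.\<close>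
    then show ?Q by (intro exI[of _ "\<lambda>r. - \<mu> r / 2"]) simp
  next
    assume ?Q
    then obtain lam where "\<forall>t\<in>{a..b}. fst (w t) = (\<Sum>r\<in>UNIV. (- 2 * lam r) *\<^sub>R (quat r *v fst (v t)))" ..
    then show ?P by (rule exI[of _ "\<lambda>r. - 2 * lam r"])
  qed
  finally show ?thesis
    by (rule trans) (intro ex_cong1 ball_cong refl eq[symmetric])
qed

end
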